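(* Let $q\in\mathbb{C}$, $q\neq 0$, be not a root of unity, let $k_0$ be the field of functions $g$ meromorphic on $\mathbb{C}\setminus\{0\}$ satisfying $g(qx)=g(x)$, let $k=k_0(x)$, $\sigma(x)=qx$ (that is, $\sigma(f)(x)=f(qx)$) and $\partial=x\frac{d}{dx}$. Let $a,b\in\mathbb{C}(x)$ with $a\neq0$ in standard form. Let $z$ be a function meromorphic on $\mathbb{C}$ satisfying $\sigma(z)=az+b$ and assume that $z\notin k$. Then: 1. If $a\neq cx^n$ for all $c\in\mathbb{C}$, $n\in\mathbb{Z}$, then $z$ is not differentially algebraic over $k$. 2. If $a=cx^n$ for some $c\in\mathbb{C}$, $n\in\mathbb{Z}$, then $z$ is differentially algebraic over $k$ if and only if one of the following holds: (a) $a=q^r$ for some $r\in\mathbb{Z}$, and $b=\sigma(f)-af+dx^r$ for some $f\in\mathbb{C}(x)$ and $d\in\mathbb{C}$; or (b) $a\neq q^r$ for every $r\in\mathbb{Z}$, and $b=\sigma(f)-af$ for some $f\in\mathbb{C}(x)$.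
   Context: $a\in\mathbb{C}(x)\setminus\{0\}$ is in standard form (for $\sigma(x)=qx$) if, for any two distinct nonzero elements $\alpha,\beta$ of the set of zeroes and poles of $a$ in $\mathbb{C}$, $\alpha\notin q^{\mathbb{Z}}\beta$. A function $z$ is differentially algebraic over the differential field $k$ if there is a nonzero differential polynomial $P\in k\{Y\}$ with $P(z,\partial z,\partial^2 z,\ldots)=0$. *)

theory Defs
  imports
    "HOL-Complex_Analysis.Complex_Analysis"
    "HOL-Library.Poly_Mapping"
    "HOL-Computational_Algebra.Polynomial"
begin

text \<open>The field of meromorphic functions on the punctured plane. HOL functions are total, so a
  meromorphic function carries arbitrary values at its singularities; two of them are identified
  if they agree outside a set that is sparse in the punctured plane.\<close>

definition mero_rel :: "(complex \<Rightarrow> complex) \<Rightarrow> (complex \<Rightarrow> complex) \<Rightarrow> bool" where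
  "mero_rel f g \<longleftrightarrow> f meromorphic_on (-{0}) \<and> g meromorphic_on (-{0}) \<and>
     (\<forall>\<^sub>\<approx>x\<in>-{0}. f x = g x)"

lemma mero_rel_part_equivp: "part_equivp mero_rel"
proof (rule part_equivpI)
  have "mero_rel (\<lambda>_. 0) (\<lambda>_. 0)"
    by (simp add: mero_rel_def meromorphic_on_const)
  thus "\<exists>f. mero_rel f f" by blast
  show "symp mero_rel"
    by (auto simp: symp_def mero_rel_def elim: eventually_mono)
  show "transp mero_rel"
    unfolding transp_def mero_rel_def by (auto elim: eventually_elim2)
qed

quotient_type mero = "complex \<Rightarrow> complex" / partial: mero_rel
  by (rule mero_rel_part_equivp)

lemma mero_relE1: "mero_rel f g \<Longrightarrow> f meromorphic_on (-{0})"
  and mero_relE2: "mero_rel f g \<Longrightarrow> g meromorphic_on (-{0})"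
  and mero_rel_ev: "mero_rel f g \<Longrightarrow> \<forall>\<^sub>\<approx>x\<in>-{0}. f x = g x"
  by (auto simp: mero_rel_def)

lemma eventually_cosparse_punctured:
  "eventually P (cosparse (-{0::complex})) \<longleftrightarrow> (\<forall>x. x \<noteq> 0 \<longrightarrow> eventually P (at x))"
  by (subst eventually_cosparse_open_eq) (auto intro: open_Compl)

lemma mero_relI:
  "f meromorphic_on (-{0}) \<Longrightarrow> g meromorphic_on (-{0}) \<Longrightarrow> (\<And>x. f x = g x) \<Longrightarrow> mero_rel f g"
  by (simp add: mero_rel_def)

lemma mero_rel_op2:
  assumes "mero_rel f g" "mero_rel f' g'"
    and "\<And>u v. u meromorphic_on (-{0}) \<Longrightarrow> v meromorphic_on (-{0}) \<Longrightarrow>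
           (\<lambda>x. h (u x) (v x)) meromorphic_on (-{0})"
  shows "mero_rel (\<lambda>x. h (f x) (f' x)) (\<lambda>x. h (g x) (g' x))"
  using assms unfolding mero_rel_def by (auto elim: eventually_elim2)

instantiation mero :: comm_ring_1
begin

lift_definition zero_mero :: mero is "\<lambda>_. 0"
  by (simp add: mero_rel_def meromorphic_on_const)

lift_definition one_mero :: mero is "\<lambda>_. 1"
  by (simp add: mero_rel_def meromorphic_on_const)

lift_definition plus_mero :: "mero \<Rightarrow> mero \<Rightarrow> mero" is "\<lambda>f g x. f x + g x"
  by (rule mero_rel_op2) (auto intro: meromorphic_intros)

lift_definition minus_mero :: "mero \<Rightarrow> mero \<Rightarrow> mero" is "\<lambda>f g x. f x - g x"
  by (rule mero_rel_op2) (auto intro: meromorphic_intros)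

lift_definition uminus_mero :: "mero \<Rightarrow> mero" is "\<lambda>f x. - f x"
  by (rule mero_rel_op2) (auto intro: meromorphic_intros)

lift_definition times_mero :: "mero \<Rightarrow> mero \<Rightarrow> mero" is "\<lambda>f g x. f x * g x"
  by (rule mero_rel_op2) (auto intro: meromorphic_intros)

instance
proof
  fix a b c :: mero
  show "a * b * c = a * (b * c)" "a * b = b * a" "1 * a = a"
    "a + b + c = a + (b + c)" "a + b = b + a" "0 + a = a" "- a + a = 0" "a - b = a + - b"
    "(a + b) * c = a * c + b * c"
    by (transfer; rule mero_relI;
        auto intro!: meromorphic_intros simp: field_simps dest: mero_relE1)+
  show "(0::mero) \<noteq> 1"
    by transfer (simp add: mero_rel_def meromorphic_on_const eventually_cosparse_punctured exI[of _ 1])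
qed

end

instantiation mero :: field
begin

lift_definition inverse_mero :: "mero \<Rightarrow> mero" is "\<lambda>f x. inverse (f x)"
  by (rule mero_rel_op2) (auto intro: meromorphic_intros)

lift_definition divide_mero :: "mero \<Rightarrow> mero \<Rightarrow> mero" is "\<lambda>f g x. f x / g x"
  by (rule mero_rel_op2) (auto intro: meromorphic_intros)

instance
proof
  fix a b :: mero
  show "a div b = a * inverse b"
    by (transfer; rule mero_relI;
        auto intro!: meromorphic_intros simp: field_simps dest: mero_relE1)
  show "inverse (0::mero) = 0"
    by transfer (simp add: mero_rel_def meromorphic_on_const)
  show "inverse a * a = 1" if "a \<noteq> 0"
    using that
  proof transfer
    fix f assume f: "mero_rel f f" and "\<not> mero_rel f (\<lambda>_. 0)"
    hence "\<not> (\<forall>\<^sub>\<approx>x\<in>-{0}. f x = 0)"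
      by (auto simp: mero_rel_def)
    moreover have "connected (-{0::complex})"
      by (intro connected_punctured_universe) auto
    ultimately have "\<forall>\<^sub>\<approx>x\<in>-{0}. f x \<noteq> 0"
      using meromorphic_imp_constant_or_avoid[OF mero_relE1[OF f], of 0] by auto
    hence "\<forall>\<^sub>\<approx>x\<in>-{0}. inverse (f x) * f x = 1"
      by eventually_elim simp
    thus "mero_rel (\<lambda>x. inverse (f x) * f x) (\<lambda>_. 1)"
      using f by (auto simp: mero_rel_def intro!: meromorphic_intros)
  qed
qed

end

lemma abs_mero_eq_iff:
  assumes "f meromorphic_on (-{0})" "g meromorphic_on (-{0})"
  shows "abs_mero f = abs_mero g \<longleftrightarrow> (\<forall>\<^sub>\<approx>x\<in>-{0}. f x = g x)"
proof -
  have "mero_rel f f" "mero_rel g g"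
    using assms by (auto simp: mero_rel_def)
  thus ?thesis
    using Quotient_rel[OF Quotient_mero, of f g] assms by (auto simp: mero_rel_def)
qed

lift_definition mero_const :: "complex \<Rightarrow> mero" is "\<lambda>c _. c"
  by (simp add: mero_rel_def meromorphic_on_const)

lift_definition mero_X :: mero is "\<lambda>x. x"
  by (simp add: mero_rel_def meromorphic_on_id)

text \<open>The operator \<open>\<sigma>\<close>. The value for \<open>q = 0\<close> is irrelevant;
  precomposition with the zero map does not respect the identification above.\<close>

lift_definition qshift :: "complex \<Rightarrow> mero \<Rightarrow> mero"
  is "\<lambda>q f x. if q = 0 then f x else f (q * x)"
proof -
  fix q f g assume fg: "mero_rel f g"
  show "mero_rel (\<lambda>x. if q = 0 then f x else f (q * x)) (\<lambda>x. if q = 0 then g x else g (q * x))"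
  proof (cases "q = 0")
    case False
    have mero: "(\<lambda>x. h (q * x)) meromorphic_on (-{0})" if "h meromorphic_on (-{0})" for h
      by (rule meromorphic_on_compose[OF that]) (use False in \<open>auto intro!: analytic_intros\<close>)
    have "eventually (\<lambda>x. f (q * x) = g (q * x)) (at x)" if "x \<noteq> 0" for x
    proof -
      have ev: "eventually (\<lambda>y. f y = g y) (at (q * x))"
        using mero_rel_ev[OF fg] that False by (auto simp: eventually_cosparse_punctured)
      have "filterlim (\<lambda>y. q * y) (at (q * x)) (at x)"
        by (rule filterlim_atI) (use False in \<open>auto intro!: tendsto_intros simp: eventually_at_filter\<close>)
      thus ?thesis
        using ev by (auto dest: eventually_compose_filterlim)
    qed
    thus ?thesis
      using False mero[OF mero_relE1[OF fg]] mero[OF mero_relE2[OF fg]]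
      by (auto simp: mero_rel_def eventually_cosparse_punctured)
  qed (use fg in simp)
qed

lift_definition euler_deriv :: "mero \<Rightarrow> mero" is "\<lambda>f x. x * deriv f x"
proof -
  fix f g assume fg: "mero_rel f g"
  have "eventually (\<lambda>x. x * deriv f x = x * deriv g x) (at x)" if "x \<noteq> 0" for x
  proof -
    have "eventually (\<lambda>y. f y = g y) (at x)"
      using mero_rel_ev[OF fg] that by (auto simp: eventually_cosparse_punctured)
    then obtain S where S: "open S" "x \<in> S" "\<And>y. y \<in> S - {x} \<Longrightarrow> f y = g y"
      unfolding eventually_at_topological by blast
    have "deriv f y = deriv g y" if "y \<in> S - {x}" for y
      by (rule deriv_cong_ev)
         (use S that in \<open>auto intro!: eventually_nhds_in_open[THEN eventually_mono, of "S - {x}"]\<close>)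
    thus ?thesis
      unfolding eventually_at_topological using S by auto
  qed
  thus "mero_rel (\<lambda>x. x * deriv f x) (\<lambda>x. x * deriv g x)"
    using mero_relE1[OF fg] mero_relE2[OF fg]
    by (auto simp: mero_rel_def eventually_cosparse_punctured intro!: meromorphic_intros)
qed

text \<open>\<open>F(t)\<close>, for a subfield \<open>F\<close> and an element \<open>t\<close> of an ambient field.\<close>

definition field_adjoin :: "'a::field set \<Rightarrow> 'a \<Rightarrow> 'a set" where
  "field_adjoin F t = {poly p t / poly r t | p r.
     (\<forall>i. coeff p i \<in> F) \<and> (\<forall>i. coeff r i \<in> F) \<and> poly r t \<noteq> 0}"

definition rat_funs :: "mero set" where
  "rat_funs = field_adjoin (range mero_const) mero_X"

definition k0_field :: "complex \<Rightarrow> mero set" where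
  "k0_field q = {g. qshift q g = g}"

definition k_field :: "complex \<Rightarrow> mero set" where
  "k_field q = field_adjoin (k0_field q) mero_X"

text \<open>A zero is expressed by the limit, as the value of a representative at a single point carries
  no information. For \<open>a = 0\<close> every nonzero point counts as a zero.\<close>

lift_definition nonzero_zeros_poles :: "mero \<Rightarrow> complex set"
  is "\<lambda>f. {\<alpha>. \<alpha> \<noteq> 0 \<and> (f \<midarrow>\<alpha>\<rightarrow> 0 \<or> is_pole f \<alpha>)}"
proof -
  fix f g assume fg: "mero_rel f g"
  have "(f \<midarrow>\<alpha>\<rightarrow> 0) = (g \<midarrow>\<alpha>\<rightarrow> 0) \<and> is_pole f \<alpha> = is_pole g \<alpha>" if "\<alpha> \<noteq> 0" for \<alpha>
  proof -
    have ev: "eventually (\<lambda>y. f y = g y) (at \<alpha>)"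
      using mero_rel_ev[OF fg] that by (auto simp: eventually_cosparse_punctured)
    show ?thesis
      by (intro conjI tendsto_cong is_pole_cong ev refl)
  qed
  thus "{\<alpha>. \<alpha> \<noteq> 0 \<and> (f \<midarrow>\<alpha>\<rightarrow> 0 \<or> is_pole f \<alpha>)} = {\<alpha>. \<alpha> \<noteq> 0 \<and> (g \<midarrow>\<alpha>\<rightarrow> 0 \<or> is_pole g \<alpha>)}"
    by auto
qed

definition standard_form :: "complex \<Rightarrow> mero \<Rightarrow> bool" where
  "standard_form q a \<longleftrightarrow>
     (\<forall>\<alpha>\<in>nonzero_zeros_poles a. \<forall>\<beta>\<in>nonzero_zeros_poles a. \<alpha> \<noteq> \<beta> \<longrightarrow>
        \<not> (\<exists>n::int. \<alpha> = (q powi n) * \<beta>))"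

text \<open>A differential polynomial in one differential indeterminate \<open>Y\<close> is a polynomial in the
  variables \<open>Y\<^sub>0, Y\<^sub>1, Y\<^sub>2, \<dots>\<close>: it maps each monomial (a finitely supported exponent
  function) to its coefficient. \<open>Y\<^sub>i\<close> is evaluated at the \<open>i\<close>-th derivative of \<open>z\<close>.\<close>

definition diff_poly_eval ::
    "('a::comm_ring_1 \<Rightarrow> 'a) \<Rightarrow> ((nat \<Rightarrow>\<^sub>0 nat) \<Rightarrow>\<^sub>0 'a) \<Rightarrow> 'a \<Rightarrow> 'a" where
  "diff_poly_eval D P z = (\<Sum>m\<in>Poly_Mapping.keys P. Poly_Mapping.lookup P m *
     (\<Prod>i\<in>Poly_Mapping.keys m. ((D ^^ i) z) ^ Poly_Mapping.lookup m i))"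

definition diff_algebraic_over :: "('a::comm_ring_1 \<Rightarrow> 'a) \<Rightarrow> 'a set \<Rightarrow> 'a \<Rightarrow> bool" where
  "diff_algebraic_over D K z \<longleftrightarrow> (\<exists>P :: (nat \<Rightarrow>\<^sub>0 nat) \<Rightarrow>\<^sub>0 'a.
     P \<noteq> 0 \<and> (\<forall>m. Poly_Mapping.lookup P m \<in> K) \<and> diff_poly_eval D P z = 0)"

end

theory Submission
  imports Defs "HOL-Computational_Algebra.Fundamental_Theorem_Algebra"
begin

text \<open>Write \<open>z\<^sub>i = \<partial>\<^sup>i z\<close>, \<open>K = \<complex>(x)\<close> and \<open>M\<^sub>i = K(z\<^sub>0, \<dots>, z\<^sub>i\<^sub>-\<^sub>1)\<close>; all of these lie in the field \<open>L\<close>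
  of functions that are meromorphic also at 0, and the elements of \<open>L\<close> fixed by \<open>\<sigma>\<close> are the constants.
  An algebraic differential equation for \<open>z\<close> over \<open>k\<close> descends to one over \<open>K\<close>, because \<open>L\<close> and
  \<open>k\<^sub>0\<close> are linearly disjoint over \<open>\<complex>\<close>. Hence \<open>z\<^sub>n \<in> M\<^sub>n\<close> for some least \<open>n\<close>, and \<open>M\<^sub>n\<close> is closed
  under \<open>\<partial>\<close>. Here \<open>n > 0\<close> as \<open>z \<notin> K\<close>; differentiating \<open>z\<^sub>n\<close> formally with respect to \<open>z\<^sub>n\<^sub>-\<^sub>1\<close> in
  \<open>\<sigma> z\<^sub>n = a z\<^sub>n + n \<partial>a z\<^sub>n\<^sub>-\<^sub>1 + \<dots>\<close> gives \<open>g \<in> M\<^sub>n\<close> with \<open>\<sigma> g = g + \<partial>a / a\<close>.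

  The same formal derivatives, one generator at a time, show that infinitely many elements of \<open>M\<^sub>n\<close> that
  satisfy equations \<open>\<sigma> g\<^sub>i - b g\<^sub>i \<in> K\<close> have a nontrivial combination with constant coefficients in \<open>K\<close>.
  Applied to the derivatives of \<open>g\<close>, this bounds the number of poles of \<open>g\<close>, and then \<open>g\<close> is rational by
  comparison of Laurent coefficients at 0. As \<open>a\<close> is in standard form, \<open>\<partial>a / a\<close> has at most one pole on each
  orbit of \<open>q\<close>, so rationality of \<open>g\<close> leaves only \<open>a = c x\<^sup>m\<close>, and \<open>m = 0\<close> by comparing constant terms.
  Now the argument applies to \<open>z\<close> in place of \<open>g\<close> and shows \<open>z \<in> K\<close>, a contradiction.

  Thus \<open>z\<close> is never differentially algebraic over \<open>k\<close>. Comparison of Laurent coefficients at 0 shows that the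
  conditions (a) and (b) also force \<open>z \<in> K\<close>, so both sides of the equivalence in the second part are
  false.\<close>

section \<open>Polynomials with coefficients in a subfield\<close>

text \<open>Since \<open>inverse 0 = 0\<close>, closure under inverses needs no exception at 0; sums
  and negatives come from differences.\<close>

definition is_subfield :: "'a::field set \<Rightarrow> bool" where
  "is_subfield F \<longleftrightarrow> 1 \<in> F \<and> (\<forall>x\<in>F. \<forall>y\<in>F. x - y \<in> F \<and> x * y \<in> F \<and> inverse x \<in> F)"

definition coeffs_in :: "'a::field set \<Rightarrow> 'a poly \<Rightarrow> bool" where
  "coeffs_in F p \<longleftrightarrow> (\<forall>i. coeff p i \<in> F)"

context
  fixes F :: "'a::field set"
  assumes F: "is_subfield F"
begin

lemma subfield_1: "1 \<in> F"
  and subfield_diff: "x \<in> F \<Longrightarrow> y \<in> F \<Longrightarrow> x - y \<in> F"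
  and subfield_mult: "x \<in> F \<Longrightarrow> y \<in> F \<Longrightarrow> x * y \<in> F"
  and subfield_inverse: "x \<in> F \<Longrightarrow> inverse x \<in> F"
  using F by (auto simp: is_subfield_def)

lemma subfield_0: "0 \<in> F"
  using subfield_diff[OF subfield_1 subfield_1] by simp

lemma subfield_uminus: "x \<in> F \<Longrightarrow> - x \<in> F"
  using subfield_diff[OF subfield_0, of x] by simp

lemma subfield_add: "x \<in> F \<Longrightarrow> y \<in> F \<Longrightarrow> x + y \<in> F"
  using subfield_diff[of x "- y"] subfield_uminus[of y] by simp

lemma subfield_divide: "x \<in> F \<Longrightarrow> y \<in> F \<Longrightarrow> x / y \<in> F"
  by (simp add: divide_inverse subfield_mult subfield_inverse)

lemma subfield_sum: "(\<And>i. i \<in> I \<Longrightarrow> f i \<in> F) \<Longrightarrow> sum f I \<in> F"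
  by (induction I rule: infinite_finite_induct) (auto simp: subfield_0 subfield_add)

lemma subfield_prod: "(\<And>i. i \<in> I \<Longrightarrow> f i \<in> F) \<Longrightarrow> prod f I \<in> F"
  by (induction I rule: infinite_finite_induct) (auto simp: subfield_1 subfield_mult)

lemma subfield_power: "x \<in> F \<Longrightarrow> x ^ n \<in> F"
  by (induction n) (auto simp: subfield_1 subfield_mult)

lemma subfield_power_int: "x \<in> F \<Longrightarrow> x powi n \<in> F"
  by (auto simp: power_int_def subfield_power subfield_inverse)

lemma subfield_of_nat: "of_nat n \<in> F"
  by (induction n) (auto simp: subfield_0 subfield_1 subfield_add)

lemmas subfield_intros = subfield_0 subfield_1 subfield_add subfield_diff subfield_uminus
  subfield_mult subfield_inverse subfield_divide subfield_sum subfield_prod subfield_power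
  subfield_power_int subfield_of_nat

lemma subfield_poly: "coeffs_in F p \<Longrightarrow> x \<in> F \<Longrightarrow> poly p x \<in> F"
  unfolding poly_altdef coeffs_in_def by (auto intro!: subfield_intros)

lemma coeffs_in_0: "coeffs_in F 0"
  and coeffs_in_add: "coeffs_in F p \<Longrightarrow> coeffs_in F r \<Longrightarrow> coeffs_in F (p + r)"
  and coeffs_in_diff: "coeffs_in F p \<Longrightarrow> coeffs_in F r \<Longrightarrow> coeffs_in F (p - r)"
  and coeffs_in_uminus: "coeffs_in F p \<Longrightarrow> coeffs_in F (- p)"
  and coeffs_in_mult: "coeffs_in F p \<Longrightarrow> coeffs_in F r \<Longrightarrow> coeffs_in F (p * r)"
  and coeffs_in_smult: "c \<in> F \<Longrightarrow> coeffs_in F p \<Longrightarrow> coeffs_in F (smult c p)"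
  and coeffs_in_pCons: "c \<in> F \<Longrightarrow> coeffs_in F p \<Longrightarrow> coeffs_in F (pCons c p)"
  and coeffs_in_monom: "c \<in> F \<Longrightarrow> coeffs_in F (monom c n)"
  and coeffs_in_pderiv: "coeffs_in F p \<Longrightarrow> coeffs_in F (pderiv p)"
  and coeffs_in_const: "c \<in> F \<Longrightarrow> coeffs_in F [:c:]"
  unfolding coeffs_in_def
  by (auto simp: coeff_mult coeff_pCons coeff_pderiv subfield_intros simp del: of_nat_Suc
      split: nat.splits intro!: subfield_intros)

lemma coeffs_in_1: "coeffs_in F 1"
  using coeffs_in_const[OF subfield_1] by (simp add: one_pCons)

lemma coeffs_in_sum: "(\<And>i. i \<in> I \<Longrightarrow> coeffs_in F (f i)) \<Longrightarrow> coeffs_in F (sum f I)"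
  by (induction I rule: infinite_finite_induct) (auto simp: coeffs_in_0 coeffs_in_add)

lemma coeffs_in_prod: "(\<And>i. i \<in> I \<Longrightarrow> coeffs_in F (f i)) \<Longrightarrow> coeffs_in F (prod f I)"
  by (induction I rule: infinite_finite_induct) (auto simp: coeffs_in_1 coeffs_in_mult)

lemma coeffs_in_map_poly:
  assumes "\<And>x. x \<in> F \<Longrightarrow> h x \<in> F" "coeffs_in F p" "h 0 = 0"
  shows "coeffs_in F (map_poly h p)"
  using assms by (auto simp: coeffs_in_def coeff_map_poly)

lemma coeffs_in_pcompose:
  assumes "coeffs_in F p" "coeffs_in F r"
  shows "coeffs_in F (pcompose p r)"
  using assms(1)
proof (induction p)
  case (pCons c p)
  have "c \<in> F" "coeffs_in F p"
    using pCons.prems unfolding coeffs_in_def by (metis coeff_pCons_0, metis coeff_pCons_Suc)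
  thus ?case
    using pCons.IH assms(2) by (auto simp: pcompose_pCons intro!: coeffs_in_add coeffs_in_const coeffs_in_mult)
qed (simp add: coeffs_in_0)

lemmas coeffs_in_intros = coeffs_in_0 coeffs_in_1 coeffs_in_add coeffs_in_diff coeffs_in_uminus
  coeffs_in_mult coeffs_in_smult coeffs_in_pCons coeffs_in_monom coeffs_in_pderiv coeffs_in_const
  coeffs_in_sum coeffs_in_prod coeffs_in_pcompose

text \<open>Long division only forms products, differences and quotients of coefficients, so
  quotient and remainder keep their coefficients in \<open>F\<close>.\<close>

lemma coeffs_in_division:
  assumes p: "coeffs_in F p" and r: "coeffs_in F r" "r \<noteq> 0"
  shows "\<exists>s t. coeffs_in F s \<and> coeffs_in F t \<and> p = s * r + t \<and> (t = 0 \<or> degree t < degree r)"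
  using p
proof (induction "degree p" arbitrary: p rule: less_induct)
  case less
  show ?case
  proof (cases "p = 0 \<or> degree p < degree r")
    case True
    thus ?thesis using less.prems by (intro exI[of _ 0] exI[of _ p]) (auto simp: coeffs_in_0)
  next
    case False
    define m where "m = monom (lead_coeff p / lead_coeff r) (degree p - degree r)"
    have m: "coeffs_in F m"
      using less.prems r unfolding m_def coeffs_in_def
      by (auto intro!: subfield_divide simp: coeff_monom subfield_0)
    have lc: "lead_coeff m = lead_coeff p / lead_coeff r" and "m \<noteq> 0"
      using False r(2) by (auto simp: m_def degree_monom_eq monom_eq_0_iff)
    have "degree (m * r) = degree p"
      using False r(2) \<open>m \<noteq> 0\<close> by (auto simp: degree_mult_eq m_def degree_monom_eq)
    moreover have "lead_coeff (m * r) = lead_coeff p"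
      unfolding lead_coeff_mult lc using r(2) by simp
    ultimately have deg: "degree (m * r) = degree p" "lead_coeff (m * r) = lead_coeff p" "m \<noteq> 0"
      using \<open>m \<noteq> 0\<close> by auto
    have c: "coeffs_in F (p - m * r)"
      using less.prems m r by (intro coeffs_in_intros)
    \<comment> \<open>The leading terms cancel. A difference of two constants is then 0, while in
      positive degree the degree drops.\<close>
    have "p - m * r = 0 \<or> degree (p - m * r) < degree p"
    proof (cases "degree p = 0")
      case True
      then obtain u where u: "p = [:u:]" by (metis degree_eq_zeroE)
      have "degree (m * r) = 0" using deg True by simp
      then obtain v where "m * r = [:v:]" by (metis degree_eq_zeroE)
      thus ?thesis using deg(2) u by simp
    next
      case False
      have "coeff (p - m * r) (degree p) = 0" using deg by simp
      moreover have "degree (p - m * r) \<le> degree p"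
        using deg(1) by (intro degree_diff_le) auto
      ultimately have "degree (p - m * r) \<noteq> degree p \<or> p - m * r = 0"
        by (metis leading_coeff_0_iff)
      thus ?thesis using \<open>degree (p - m * r) \<le> degree p\<close> by auto
    qed
    hence "\<exists>s t. coeffs_in F s \<and> coeffs_in F t \<and> p - m * r = s * r + t \<and> (t = 0 \<or> degree t < degree r)"
      using less.hyps[OF _ c] coeffs_in_0 by (elim disjE) (metis add.right_neutral mult_zero_left, blast)
    then obtain s t where st: "coeffs_in F s" "coeffs_in F t" "p - m * r = s * r + t"
      "t = 0 \<or> degree t < degree r" by blast
    show ?thesis
      using st m by (intro exI[of _ "s + m"] exI[of _ t]) (auto simp: algebra_simps intro: coeffs_in_add)
  qed
qed

section \<open>Simple field extensions\<close>

lemma field_adjoin_iff: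
  "g \<in> field_adjoin F t \<longleftrightarrow>
     (\<exists>p r. coeffs_in F p \<and> coeffs_in F r \<and> poly r t \<noteq> 0 \<and> g = poly p t / poly r t)"
  by (auto simp: field_adjoin_def coeffs_in_def)

lemma field_adjoinE:
  assumes "g \<in> field_adjoin F t"
  obtains p r where "coeffs_in F p" "coeffs_in F r" "poly r t \<noteq> 0" "g = poly p t / poly r t"
  using assms by (auto simp: field_adjoin_iff)

text \<open>By the convention \<open>x / 0 = 0\<close>, a vanishing denominator yields 0, which also
  lies in the extension.\<close>

lemma field_adjoinI:
  assumes "coeffs_in F p" "coeffs_in F r" "g = poly p t / poly r t"
  shows "g \<in> field_adjoin F t"
proof (cases "poly r t = 0")
  case True
  thus ?thesis unfolding field_adjoin_iff
    using assms by (intro exI[of _ 0] exI[of _ 1]) (auto simp: coeffs_in_intros)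
qed (use assms in \<open>auto simp: field_adjoin_iff\<close>)

lemma field_adjoin_poly: "coeffs_in F p \<Longrightarrow> poly p t \<in> field_adjoin F t"
  by (rule field_adjoinI[of p 1]) (auto simp: coeffs_in_1)

lemma field_adjoin_base: "F \<subseteq> field_adjoin F t"
  using field_adjoin_poly[of "[:c:]" t for c] by (auto simp: coeffs_in_const)

lemma field_adjoin_gen: "t \<in> field_adjoin F t"
  using field_adjoin_poly[of "[:0, 1:]" t]
  by (simp add: coeffs_in_pCons coeffs_in_0 subfield_0 subfield_1)

lemma is_subfield_field_adjoin: "is_subfield (field_adjoin F t)"
  unfolding is_subfield_def
proof (intro conjI ballI)
  show "1 \<in> field_adjoin F t"
    using field_adjoin_poly[OF coeffs_in_1] by simp
  fix x y assume "x \<in> field_adjoin F t" "y \<in> field_adjoin F t"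
  then obtain p r p' r' where *: "coeffs_in F p" "coeffs_in F r" "poly r t \<noteq> 0" "x = poly p t / poly r t"
    "coeffs_in F p'" "coeffs_in F r'" "poly r' t \<noteq> 0" "y = poly p' t / poly r' t"
    by (metis field_adjoinE)
  show "x - y \<in> field_adjoin F t"
    by (rule field_adjoinI[of "p * r' - p' * r" "r * r'"])
       (use * in \<open>auto intro!: coeffs_in_intros simp: diff_frac_eq\<close>)
  show "x * y \<in> field_adjoin F t"
    by (rule field_adjoinI[of "p * p'" "r * r'"]) (use * in \<open>auto intro!: coeffs_in_intros\<close>)
  show "inverse x \<in> field_adjoin F t"
    by (rule field_adjoinI[of r p]) (use * in \<open>auto intro!: coeffs_in_intros\<close>)
qed

end

lemma coeffs_in_mono: "coeffs_in F p \<Longrightarrow> F \<subseteq> G \<Longrightarrow> coeffs_in G p"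
  by (auto simp: coeffs_in_def)

lemma field_adjoin_least:
  assumes "is_subfield F" "is_subfield G" "F \<subseteq> G" "t \<in> G"
  shows "field_adjoin F t \<subseteq> G"
proof
  fix g assume "g \<in> field_adjoin F t"
  then obtain p r where "coeffs_in F p" "coeffs_in F r" "g = poly p t / poly r t"
    using field_adjoinE[OF assms(1)] by metis
  thus "g \<in> G"
    using assms by (auto intro!: subfield_divide subfield_poly intro: coeffs_in_mono)
qed

text \<open>Elements of a simple algebraic extension are polynomials in the generator; the inverse of a
  value is found by dividing the annihilating polynomial of the generator.\<close>

lemma inverse_poly_algebraic:
  fixes M :: "'a::field set"
  assumes M: "is_subfield M" and P: "coeffs_in M P" "P \<noteq> 0" "poly P y = 0"
    and min: "\<And>p. coeffs_in M p \<Longrightarrow> p \<noteq> 0 \<Longrightarrow> poly p y = 0 \<Longrightarrow> degree P \<le> degree p"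
    and r: "coeffs_in M r" "r \<noteq> 0" "degree r < degree P"
  shows "\<exists>s. coeffs_in M s \<and> poly s y * poly r y = 1"
  using r
proof (induction "degree r" arbitrary: r rule: less_induct)
  case less
  show ?case
  proof (cases "degree r = 0")
    case True
    then obtain c where c: "r = [:c:]" by (metis degree_eq_zeroE)
    with less.prems have "c \<noteq> 0" "c \<in> M"
      unfolding coeffs_in_def by (auto, metis coeff_pCons_0)
    thus ?thesis
      using c M by (intro exI[of _ "[:inverse c:]"]) (auto intro!: coeffs_in_intros subfield_inverse)
  next
    case False
    obtain s t where st: "coeffs_in M s" "coeffs_in M t" "P = s * r + t" "t = 0 \<or> degree t < degree r"
      using coeffs_in_division[OF M P(1) less.prems(1,2)] by blast
    have eq: "poly s y * poly r y = - poly t y"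
      using P(3) st(3) by (simp add: add_eq_0_iff)
    show ?thesis
    proof (cases "t = 0")
      case True
      with st P have s: "s \<noteq> 0" by auto
      \<comment> \<open>With remainder 0, one of \<open>s\<close> and \<open>r\<close> would
        annihilate \<open>y\<close> in a degree below that of \<open>P\<close>.\<close>
      have "poly s y = 0 \<or> poly r y = 0"
        using eq True by simp
      moreover have "degree s < degree P"
        using st(3) True s less.prems(2) False by (simp add: degree_mult_eq)
      ultimately show ?thesis
        using min[OF st(1) s] min[OF less.prems(1,2)] less.prems(3) by linarith
    next
      case t: False
      hence lt: "degree t < degree r" using st by auto
      then obtain u where u: "coeffs_in M u" "poly u y * poly t y = 1"
        using less.hyps[OF lt st(2) t] less.prems by auto
      \<comment> \<open>At \<open>y\<close> the value of \<open>s * r\<close> is minus that of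
        \<open>t\<close>, so the inverse \<open>u\<close> for \<open>t\<close> yields the inverse
        \<open>- s * u\<close> for \<open>r\<close>.\<close>
      have "poly (- s * u) y * poly r y = - (poly s y * poly r y) * poly u y"
        by (simp add: algebra_simps)
      also have "\<dots> = 1" using eq u by (simp add: mult.commute)
      finally show ?thesis
        using M st u by (intro exI[of _ "- s * u"]) (auto intro!: coeffs_in_intros)
    qed
  qed
qed

text \<open>The reduced denominator is inverted, and the product with the numerator is reduced
  modulo \<open>P\<close> once more.\<close>

lemma field_adjoin_algebraic:
  fixes M :: "'a::field set"
  assumes M: "is_subfield M" and P: "coeffs_in M P" "P \<noteq> 0" "poly P y = 0"
    and min: "\<And>p. coeffs_in M p \<Longrightarrow> p \<noteq> 0 \<Longrightarrow> poly p y = 0 \<Longrightarrow> degree P \<le> degree p"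
    and g: "g \<in> field_adjoin M y"
  shows "\<exists>p. coeffs_in M p \<and> degree p < degree P \<and> g = poly p y"
proof -
  have P0: "degree P > 0"
    using P by (metis bot_nat_0.not_eq_extremum degree_eq_zeroE mult_zero_right add.right_neutral
        pCons_0_0 poly_pCons poly_0)
  have red: "\<exists>t. coeffs_in M t \<and> degree t < degree P \<and> poly p y = poly t y" if "coeffs_in M p" for p
    using coeffs_in_division[OF M that P(1,2)] P(3) P0 by fastforce
  obtain p r where pr: "coeffs_in M p" "coeffs_in M r" "poly r y \<noteq> 0" "g = poly p y / poly r y"
    using g by (rule field_adjoinE[OF M])
  obtain r' where r': "coeffs_in M r'" "degree r' < degree P" "poly r y = poly r' y"
    using red[OF pr(2)] by blast
  then obtain s where s: "coeffs_in M s" "poly s y * poly r' y = 1"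
    using inverse_poly_algebraic[OF M P min, of r'] pr by fastforce
  have "g = poly (p * s) y"
    using s pr r' by (simp add: nonzero_divide_eq_eq mult.assoc)
  thus ?thesis
    using red[of "p * s"] pr s M by (auto intro: coeffs_in_mult)
qed

lemma minimal_annihilator:
  assumes "coeffs_in M P" "P \<noteq> 0" "poly P y = 0"
  obtains Q where "coeffs_in M Q" "Q \<noteq> 0" "poly Q y = 0"
    "\<And>p. coeffs_in M p \<Longrightarrow> p \<noteq> 0 \<Longrightarrow> poly p y = 0 \<Longrightarrow> degree Q \<le> degree p"
  using exists_least_iff[of "\<lambda>n. \<exists>Q. coeffs_in M Q \<and> Q \<noteq> 0 \<and> poly Q y = 0 \<and> degree Q = n"] assms
  by (metis not_le_imp_less)

section \<open>Difference fields and simple extensions\<close>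

locale difference_field =
  fixes \<sigma> :: "'a::field_char_0 \<Rightarrow> 'a"
  assumes shift_add: "\<sigma> (x + y) = \<sigma> x + \<sigma> y"
    and shift_mult: "\<sigma> (x * y) = \<sigma> x * \<sigma> y"
    and shift_1: "\<sigma> 1 = 1"
begin

lemma shift_0: "\<sigma> 0 = 0"
  using shift_add[of 0 0] by simp

lemma shift_uminus: "\<sigma> (- x) = - \<sigma> x"
  using shift_add[of x "- x"] by (simp add: shift_0 add_eq_0_iff)

lemma shift_diff: "\<sigma> (x - y) = \<sigma> x - \<sigma> y"
  using shift_add[of x "- y"] by (simp add: shift_uminus)

lemma shift_eq_0_iff: "\<sigma> x = 0 \<longleftrightarrow> x = 0"
proof
  assume *: "\<sigma> x = 0"
  show "x = 0"
  proof (rule ccontr)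
    assume "x \<noteq> 0"
    hence "\<sigma> x * \<sigma> (inverse x) = 1" by (simp flip: shift_mult add: shift_1)
    with * show False by simp
  qed
qed (simp add: shift_0)

lemma shift_inverse: "\<sigma> (inverse x) = inverse (\<sigma> x)"
proof (cases "x = 0")
  case False
  hence "\<sigma> x * \<sigma> (inverse x) = 1" by (simp flip: shift_mult add: shift_1)
  thus ?thesis by (metis inverse_unique)
qed (simp add: shift_0)

lemma shift_divide: "\<sigma> (x / y) = \<sigma> x / \<sigma> y"
  by (simp add: divide_inverse shift_mult shift_inverse)

lemma shift_sum: "\<sigma> (sum f I) = (\<Sum>i\<in>I. \<sigma> (f i))"
  by (induction I rule: infinite_finite_induct) (auto simp: shift_0 shift_add)

lemma shift_power: "\<sigma> (x ^ n) = \<sigma> x ^ n"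
  by (induction n) (auto simp: shift_1 shift_mult)

lemma shift_power_int: "\<sigma> (x powi n) = \<sigma> x powi n"
  by (auto simp: power_int_def shift_power shift_inverse)

lemma shift_of_nat: "\<sigma> (of_nat n) = of_nat n"
  by (induction n) (auto simp: shift_0 shift_1 shift_add)

lemma shift_poly: "\<sigma> (poly p x) = poly (map_poly \<sigma> p) (\<sigma> x)"
  by (induction p) (auto simp: shift_0 map_poly_pCons shift_add shift_mult)

lemmas shift_simps = shift_0 shift_1 shift_add shift_uminus shift_diff shift_mult shift_inverse
  shift_divide shift_sum shift_power shift_power_int shift_of_nat

lemma pderiv_map_poly_shift: "pderiv (map_poly \<sigma> p) = map_poly \<sigma> (pderiv p)"
  by (rule poly_eqI) (simp add: coeff_pderiv coeff_map_poly shift_simps del: of_nat_Suc)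

lemma is_subfield_fixed: "is_subfield {x. \<sigma> x = x}"
  by (auto simp: is_subfield_def shift_simps)

end

locale affine_generator = difference_field \<sigma> for \<sigma> :: "'a::field_char_0 \<Rightarrow> 'a" +
  fixes M :: "'a set" and y a \<mu> :: 'a
  assumes M: "is_subfield M" and shift_M: "x \<in> M \<Longrightarrow> \<sigma> x \<in> M"
    and a: "a \<in> M" "a \<noteq> 0" and \<mu>: "\<mu> \<in> M" and shift_y: "\<sigma> y = a * y + \<mu>"
begin

text \<open>This lifts the action of \<sigma> on values at \<open>y\<close> to polynomials, as
  \<open>poly_twist\<close> confirms.\<close>

definition twist :: "'a poly \<Rightarrow> 'a poly" where
  "twist p = pcompose (map_poly \<sigma> p) [:\<mu>, a:]"

lemma poly_twist: "poly (twist p) y = \<sigma> (poly p y)"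
  by (simp add: twist_def poly_pcompose shift_poly shift_y add.commute mult.commute)

lemma coeffs_in_twist: "coeffs_in M p \<Longrightarrow> coeffs_in M (twist p)"
  unfolding twist_def using M a \<mu>
  by (intro coeffs_in_pcompose coeffs_in_map_poly coeffs_in_pCons coeffs_in_0 shift_M shift_0)

lemma degree_twist: "degree (twist p) = degree p"
  using a by (simp add: twist_def degree_pcompose degree_map_poly shift_eq_0_iff)

text \<open>The chain rule, with inner derivative \<open>a\<close>. This is the source of the factor
  \<open>a\<close> whenever \<sigma> passes a formal derivative.\<close>

lemma pderiv_twist: "pderiv (twist p) = smult a (twist (pderiv p))"
  by (simp add: twist_def pderiv_pcompose pderiv_map_poly_shift pderiv_pCons)

lemma shift_field_adjoin:
  assumes "g \<in> field_adjoin M y"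
  shows "\<sigma> g \<in> field_adjoin M y"
proof -
  obtain p r where "coeffs_in M p" "coeffs_in M r" "g = poly p y / poly r y"
    using assms field_adjoinE[OF M] by metis
  thus ?thesis
    by (intro field_adjoinI[OF M, of "twist p" "twist r"]) (auto simp: coeffs_in_twist poly_twist shift_divide)
qed

end

text \<open>The equation says that \<open>p / r\<close> has derivative 0. In characteristic 0 the
  quotient is then constant, namely the ratio of the leading coefficients.\<close>

lemma ratio_in_subfield:
  fixes M :: "'a::field_char_0 set"
  assumes M: "is_subfield M" and pr: "coeffs_in M p" "coeffs_in M r" "r \<noteq> 0"
    and eq: "pderiv p * r = p * pderiv r"
  shows "\<exists>c\<in>M. p = smult c r"
proof (cases "p = 0")
  case True
  thus ?thesis using subfield_0[OF M] by (intro bexI[of _ 0]) auto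
next
  case False
  \<comment> \<open>The comparison of degrees is made for an arbitrary solution, because it is
    applied again to \<open>p - smult c r\<close>, whose coefficient in that degree
    vanishes.\<close>
  have deg: "degree p = degree r" if "p \<noteq> 0" "pderiv p * r = p * pderiv r" for p
  proof (cases "degree p = 0 \<or> degree r = 0")
    case True
    hence "pderiv p = 0 \<or> pderiv r = 0"
      by (simp add: pderiv_eq_0_iff)
    hence "pderiv p = 0 \<and> pderiv r = 0"
      using that pr(3) by (metis mult_eq_0_iff)
    thus ?thesis by (simp add: pderiv_eq_0_iff)
  next
    case False
    have lc: "lead_coeff (pderiv p) = of_nat (degree p) * lead_coeff p"
      if "degree p > 0" for p :: "'a poly"
      using that by (simp add: coeff_pderiv degree_pderiv del: of_nat_Suc)
    have "lead_coeff (pderiv p) * lead_coeff r = lead_coeff p * lead_coeff (pderiv r)"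
      using that by (simp flip: lead_coeff_mult)
    hence "of_nat (degree p) = (of_nat (degree r) :: 'a)"
      unfolding lc[of p, OF False[simplified, THEN conjunct1]] lc[of r, OF False[simplified, THEN conjunct2]]
      using that pr(3) by simp
    thus ?thesis by simp
  qed
  define c where "c = lead_coeff p / lead_coeff r"
  have c: "c \<in> M"
    unfolding c_def using pr M by (auto simp: coeffs_in_def intro!: subfield_divide)
  have "p = smult c r"
  proof (rule ccontr)
    assume "p \<noteq> smult c r"
    hence nz: "p - smult c r \<noteq> 0" by simp
    have "pderiv (p - smult c r) * r = (p - smult c r) * pderiv r"
      using eq by (simp add: pderiv_diff pderiv_smult algebra_simps)
    hence "degree (p - smult c r) = degree r" by (rule deg[OF nz])
    moreover have "coeff (p - smult c r) (degree r) = 0"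
      using deg[OF False eq] pr by (simp add: c_def)
    ultimately show False using nz by (metis leading_coeff_0_iff)
  qed
  thus ?thesis using c by blast
qed

context affine_generator
begin

text \<open>If \<open>y\<close> is transcendental over \<open>M\<close>, the operator is differentiation with respect to \<open>y\<close>.
  If \<open>y\<close> is algebraic of degree \<open>m\<close>, the operator sends \<open>p(y)\<close> to \<open>p'(y)\<close> for polynomials \<open>p\<close>
  of degree less than \<open>m\<close>; this is not a derivation, but it is linear and compatible with
  \<open>\<sigma>\<close> because \<open>\<sigma>\<close> preserves the degree in \<open>y\<close>.\<close>

lemma linear_derivative_exists:
  assumes y: "y \<notin> M"
  obtains D where
    "\<And>g. g \<in> field_adjoin M y \<Longrightarrow> D g \<in> field_adjoin M y"
    "\<And>g. g \<in> field_adjoin M y \<Longrightarrow> D g = 0 \<Longrightarrow> g \<in> M"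
    "\<And>g h. g \<in> field_adjoin M y \<Longrightarrow> h \<in> field_adjoin M y \<Longrightarrow> D (g + h) = D g + D h"
    "\<And>e g. e \<in> M \<Longrightarrow> g \<in> field_adjoin M y \<Longrightarrow> D (e * g) = e * D g"
    "\<And>e. e \<in> M \<Longrightarrow> D e = 0"
    "D y = 1"
    "\<And>g. g \<in> field_adjoin M y \<Longrightarrow> D (\<sigma> g) = a * \<sigma> (D g)"
proof (cases "\<exists>P. coeffs_in M P \<and> P \<noteq> 0 \<and> poly P y = 0")
  case True
  then obtain P where P: "coeffs_in M P" "P \<noteq> 0" "poly P y = 0"
    and min: "\<And>p. coeffs_in M p \<Longrightarrow> p \<noteq> 0 \<Longrightarrow> poly p y = 0 \<Longrightarrow> degree P \<le> degree p"
    using minimal_annihilator by (metis (no_types, lifting))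
  define m where "m = degree P"
  \<comment> \<open>An annihilator of degree at most 1 would put \<open>y\<close> into
    \<open>M\<close>. The bound makes \<open>[:0, 1:]\<close> a reduced representative, hence
    \<open>D y = 1\<close>.\<close>
  have m: "m > 1"
  proof (rule ccontr)
    assume "\<not> m > 1"
    hence "degree P \<le> 1" by (simp add: m_def)
    then obtain u v where uv: "P = [:u, v:]"
      by (metis degree1_coeffs degree_0_id le_Suc_eq le_zero_eq One_nat_def pCons_0_0 degree_eq_zeroE)
    hence "u \<in> M" "v \<in> M"
      using P(1) unfolding coeffs_in_def by (metis coeff_pCons_0, metis coeff_pCons_0 coeff_pCons_Suc)
    moreover have "v \<noteq> 0" "v * y = - u"
      using P(2,3) uv by (auto simp: add_eq_0_iff mult.commute)
    hence "y = - u / v"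
      by (metis nonzero_mult_div_cancel_left)
    ultimately show False
      using y M by (auto intro: subfield_intros)
  qed
  have uniq: "p = r" if "coeffs_in M p" "coeffs_in M r" "degree p < m" "degree r < m" "poly p y = poly r y" for p r
  proof (rule ccontr)
    assume "p \<noteq> r"
    hence "m \<le> degree (p - r)"
      unfolding m_def using that M by (intro min) (auto intro: coeffs_in_diff)
    thus False using degree_diff_less[of p m r] that by simp
  qed
  define D where "D g = (THE d. \<exists>p. coeffs_in M p \<and> degree p < m \<and> g = poly p y \<and> d = poly (pderiv p) y)" for g
  have D: "D (poly p y) = poly (pderiv p) y" if "coeffs_in M p" "degree p < m" for p
    unfolding D_def
  proof (rule the_equality)
    fix d assume "\<exists>r. coeffs_in M r \<and> degree r < m \<and> poly p y = poly r y \<and> d = poly (pderiv r) y"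
    then obtain r where "coeffs_in M r" "degree r < m" "poly p y = poly r y" "d = poly (pderiv r) y"
      by blast
    thus "d = poly (pderiv p) y" using uniq[of p r] that by simp
  qed (use that in blast)
  have ex: "\<exists>p. coeffs_in M p \<and> degree p < m \<and> g = poly p y" if "g \<in> field_adjoin M y" for g
    unfolding m_def by (rule field_adjoin_algebraic[OF M P _ that]) (rule min)
  show thesis
  proof
    fix g h assume "g \<in> field_adjoin M y" "h \<in> field_adjoin M y"
    then obtain p r where p: "coeffs_in M p" "degree p < m" "g = poly p y"
      and r: "coeffs_in M r" "degree r < m" "h = poly r y"
      using ex by metis
    show "D (g + h) = D g + D h"
      using D[of "p + r"] D[of p] D[of r] p r M by (simp add: degree_add_less coeffs_in_add pderiv_add)
  next
    fix g assume "g \<in> field_adjoin M y"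
    then obtain p where p: "coeffs_in M p" "degree p < m" "g = poly p y"
      using ex by metis
    show "D g \<in> field_adjoin M y"
      using D[of p] p M by (simp add: field_adjoin_poly coeffs_in_pderiv)
    show "D (\<sigma> g) = a * \<sigma> (D g)"
      using D[of "twist p"] D[of p] p by (simp add: coeffs_in_twist degree_twist pderiv_twist poly_twist)
    show "D (e * g) = e * D g" if "e \<in> M" for e
      using D[of "smult e p"] D[of p] p M that le_less_trans[OF degree_smult_le[of e p]]
      by (simp add: coeffs_in_smult pderiv_smult)
    show "g \<in> M" if "D g = 0"
    proof -
      have "pderiv p = 0"
        using uniq[of "pderiv p" 0] D[of p] p that M m
        by (simp add: coeffs_in_0 coeffs_in_pderiv degree_pderiv)
      then obtain c where "p = [:c:]" using pderiv_iszero by blast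
      thus ?thesis using p unfolding coeffs_in_def by (auto, metis coeff_pCons_0)
    qed
  next
    show "D e = 0" if "e \<in> M" for e
      using D[of "[:e:]"] that m M by (simp add: coeffs_in_const)
    show "D y = 1"
      using D[of "[:0, 1:]"] m M
      by (simp add: coeffs_in_pCons subfield_0 subfield_1 coeffs_in_0 pderiv_pCons)
  qed
next
  case False
  hence tr: "p = 0" if "coeffs_in M p" "poly p y = 0" for p
    using that by blast
  \<comment> \<open>The quotient rule; \<open>uniq\<close> shows that the value does not depend on
    the fraction chosen.\<close>
  define Q where "Q p r = poly (pderiv p * r - p * pderiv r) y / (poly r y)\<^sup>2" for p r
  have uniq: "Q p r = Q p' r'"
    if "coeffs_in M p" "coeffs_in M r" "poly r y \<noteq> 0" "coeffs_in M p'" "coeffs_in M r'" "poly r' y \<noteq> 0"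
      "poly p y / poly r y = poly p' y / poly r' y" for p r p' r'
  proof -
    define u v w x where "u = poly p y" and "v = poly r y" and "w = poly p' y" and "x = poly r' y"
    define u' v' w' x' where "u' = poly (pderiv p) y" and "v' = poly (pderiv r) y"
      and "w' = poly (pderiv p') y" and "x' = poly (pderiv r') y"
    have nz: "v \<noteq> 0" "x \<noteq> 0" using that by (auto simp: v_def x_def)
    \<comment> \<open>Transcendence lifts the equality of values to an identity of polynomials,
      which can then be differentiated formally.\<close>
    have "p * r' - p' * r = 0"
      by (rule tr) (use that M in \<open>auto intro!: coeffs_in_intros simp: field_simps\<close>)
    hence "pderiv (p * r') = pderiv (p' * r)" by simp
    from arg_cong[OF this, of "\<lambda>q. poly q y"]
    have e1: "u * x' + x * u' = w * v' + v * w'"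
      by (simp add: pderiv_mult u_def v_def w_def x_def u'_def v'_def w'_def x'_def)
    have e2: "u * x = w * v"
      using that by (simp add: u_def v_def w_def x_def field_simps)
    have "(u' * v - u * v') * x\<^sup>2 = (w' * x - w * x') * v\<^sup>2"
      using e1 e2 nz by algebra
    thus ?thesis
      using nz by (simp add: Q_def u_def v_def w_def x_def u'_def v'_def w'_def x'_def frac_eq_eq)
  qed
  define D where "D g = (THE d. \<exists>p r. coeffs_in M p \<and> coeffs_in M r \<and> poly r y \<noteq> 0 \<and>
    g = poly p y / poly r y \<and> d = Q p r)" for g
  have D: "D (poly p y / poly r y) = Q p r" if "coeffs_in M p" "coeffs_in M r" "poly r y \<noteq> 0" for p r
    unfolding D_def
  proof (rule the_equality)
    fix d assume "\<exists>p' r'. coeffs_in M p' \<and> coeffs_in M r' \<and> poly r' y \<noteq> 0 \<and>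
      poly p y / poly r y = poly p' y / poly r' y \<and> d = Q p' r'"
    then obtain p' r' where "coeffs_in M p'" "coeffs_in M r'" "poly r' y \<noteq> 0"
      "poly p y / poly r y = poly p' y / poly r' y" "d = Q p' r'"
      by blast
    thus "d = Q p r" using uniq[of p r p' r'] that by simp
  qed (use that in blast)
  show thesis
  proof
    fix g h assume "g \<in> field_adjoin M y" "h \<in> field_adjoin M y"
    then obtain p r p' r' where p: "coeffs_in M p" "coeffs_in M r" "poly r y \<noteq> 0" "g = poly p y / poly r y"
      and r: "coeffs_in M p'" "coeffs_in M r'" "poly r' y \<noteq> 0" "h = poly p' y / poly r' y"
      by (metis field_adjoinE[OF M])
    have "D (poly (p * r' + p' * r) y / poly (r * r') y) = Q (p * r' + p' * r) (r * r')"
      using p r M by (intro D) (auto intro!: coeffs_in_intros)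
    moreover have "poly (p * r' + p' * r) y / poly (r * r') y = g + h"
      using p r by (simp add: add_frac_eq mult.commute)
    moreover have "Q (p * r' + p' * r) (r * r') = Q p r + Q p' r'"
      using p(3) r(3) by (simp add: Q_def pderiv_add pderiv_mult divide_simps)
        (simp add: algebra_simps power2_eq_square)
    ultimately show "D (g + h) = D g + D h"
      using D[of p r] D[of p' r'] p r by simp
  next
    fix g assume "g \<in> field_adjoin M y"
    then obtain p r where p: "coeffs_in M p" "coeffs_in M r" "poly r y \<noteq> 0" "g = poly p y / poly r y"
      by (metis field_adjoinE[OF M])
    have Dg: "D g = Q p r" using D p by simp
    show "D g \<in> field_adjoin M y"
      unfolding Dg Q_def using p M
      by (intro field_adjoinI[of _ "pderiv p * r - p * pderiv r" "r^2"])
         (auto intro!: coeffs_in_intros simp: power2_eq_square)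
    show "D (\<sigma> g) = a * \<sigma> (D g)"
    proof -
      have "D (poly (twist p) y / poly (twist r) y) = Q (twist p) (twist r)"
        using p by (intro D) (auto simp: coeffs_in_twist poly_twist shift_eq_0_iff)
      also have "\<dots> = a * \<sigma> (Q p r)"
        by (simp add: Q_def pderiv_twist poly_twist shift_simps right_diff_distrib mult.assoc mult.left_commute)
      finally show ?thesis using p Dg by (simp add: poly_twist shift_divide)
    qed
    show "D (e * g) = e * D g" if "e \<in> M" for e
    proof -
      have "D (poly (smult e p) y / poly r y) = Q (smult e p) r"
        using p that M by (intro D) (auto intro!: coeffs_in_intros)
      also have "\<dots> = e * Q p r"
        by (simp add: Q_def pderiv_smult right_diff_distrib mult.assoc)
      finally show ?thesis using p Dg by simp
    qed
    show "g \<in> M" if "D g = 0"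
    proof -
      have "pderiv p * r - p * pderiv r = 0"
        using that p M unfolding Dg Q_def by (intro tr) (auto intro!: coeffs_in_intros)
      then obtain c where "c \<in> M" "p = smult c r"
        using ratio_in_subfield[OF M p(1,2)] p(3) by (metis poly_0 right_minus_eq)
      thus ?thesis using p by simp
    qed
  next
    show "D e = 0" if "e \<in> M" for e
      using D[of "[:e:]" 1] that M by (simp add: coeffs_in_const coeffs_in_1 Q_def)
    show "D y = 1"
      using D[of "[:0, 1:]" 1] M
      by (simp add: coeffs_in_pCons subfield_0 subfield_1 coeffs_in_0 coeffs_in_1 pderiv_pCons Q_def)
  qed
qed

end

section \<open>Towers of derivatives\<close>

lemma sum_lessThan_double:
  fixes f :: "nat \<Rightarrow> 'a::comm_monoid_add"
  shows "(\<Sum>k<2*n. f k) = (\<Sum>i<n. f (2*i) + f (2*i+1))"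
  by (induction n) (auto simp: add.assoc)

primrec tower :: "'a::field set \<Rightarrow> (nat \<Rightarrow> 'a) \<Rightarrow> nat \<Rightarrow> 'a set" where
  "tower K t 0 = K"
| "tower K t (Suc n) = field_adjoin (tower K t n) (t n)"

lemma is_subfield_tower: "is_subfield K \<Longrightarrow> is_subfield (tower K t n)"
  by (induction n) (auto intro: is_subfield_field_adjoin)

lemma tower_Suc_mono: "is_subfield K \<Longrightarrow> tower K t n \<subseteq> tower K t (Suc n)"
  by (simp add: field_adjoin_base is_subfield_tower)

lemma tower_mono: "is_subfield K \<Longrightarrow> m \<le> n \<Longrightarrow> tower K t m \<subseteq> tower K t n"
  by (rule lift_Suc_mono_le[of "tower K t"]) (rule tower_Suc_mono)

lemma tower_base: "is_subfield K \<Longrightarrow> K \<subseteq> tower K t n"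
  using tower_mono[of K 0 n] by simp

lemma tower_gen: "is_subfield K \<Longrightarrow> i < n \<Longrightarrow> t i \<in> tower K t n"
  using tower_mono[of K "Suc i" n t] field_adjoin_gen[of "tower K t i"] is_subfield_tower[of K t i]
  by (metis Suc_leI subsetD tower.simps(2))

lemma tower_subset:
  assumes "is_subfield K" "is_subfield L" "K \<subseteq> L" "\<And>i. i < n \<Longrightarrow> t i \<in> L"
  shows "tower K t n \<subseteq> L"
  using assms(4)
proof (induction n)
  case (Suc n)
  hence "tower K t n \<subseteq> L" "t n \<in> L" by auto
  thus ?case
    using field_adjoin_least[OF is_subfield_tower[OF assms(1)] assms(2)] by simp
qed (use assms in simp)

text \<open>The formal derivative \<open>D\<close> with respect to \<open>y\<close> kills the
  remainder in \<open>M\<close>. Applied to the equation for \<open>x\<close> it leaves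
  \<open>a * \<sigma> (D x) = a * D x + u\<close>, so \<open>h = D x\<close> works.\<close>

lemma (in affine_generator) additive_equation_from_derivative:
  assumes "y \<notin> M" and x: "x \<in> field_adjoin M y" and u: "u \<in> M"
    and \<rho>: "\<sigma> x - a * x - u * y \<in> M"
  shows "\<exists>h\<in>field_adjoin M y. \<sigma> h = h + u / a"
proof -
  let ?N = "field_adjoin M y" and ?\<rho> = "\<sigma> x - a * x - u * y"
  have N: "is_subfield ?N" "M \<subseteq> ?N" and y: "y \<in> ?N"
    using is_subfield_field_adjoin[OF M] field_adjoin_base[OF M] field_adjoin_gen[OF M] by auto
  obtain D where D_N: "\<And>g. g \<in> ?N \<Longrightarrow> D g \<in> ?N"
    and "\<And>g. g \<in> ?N \<Longrightarrow> D g = 0 \<Longrightarrow> g \<in> M"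
    and D_add: "\<And>g h. g \<in> ?N \<Longrightarrow> h \<in> ?N \<Longrightarrow> D (g + h) = D g + D h"
    and D_mult: "\<And>e g. e \<in> M \<Longrightarrow> g \<in> ?N \<Longrightarrow> D (e * g) = e * D g"
    and D_M: "\<And>e. e \<in> M \<Longrightarrow> D e = 0"
    and D_y: "D y = 1"
    and D_shift: "\<And>g. g \<in> ?N \<Longrightarrow> D (\<sigma> g) = a * \<sigma> (D g)"
  proof (rule linear_derivative_exists[OF assms(1)], goal_cases)
    case (1 D)
    from 1(2-) show thesis by (rule 1(1))
  qed
  have ax: "a * x \<in> ?N" and uy: "u * y \<in> ?N" and \<rho>N: "?\<rho> \<in> ?N"
    using subfield_mult[OF N(1)] N(2) x y u a(1) \<rho> by blast+
  have "D (a * x + (u * y + ?\<rho>)) = a * D x + u"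
    using D_add[OF ax subfield_add[OF N(1) uy \<rho>N]] D_add[OF uy \<rho>N] D_mult[OF a(1) x] D_mult[OF u y]
      D_M[OF \<rho>] D_y by simp
  hence "a * \<sigma> (D x) = a * D x + u"
    using D_shift[OF x] by simp
  hence "\<sigma> (D x) = D x + u / a"
    using a by (simp add: field_simps)
  thus ?thesis using D_N[OF x] by blast
qed

section \<open>Constants and elimination of generators\<close>

locale difference_subfield = difference_field \<sigma> for \<sigma> :: "'a::field_char_0 \<Rightarrow> 'a" +
  fixes L K :: "'a set"
  assumes L: "is_subfield L" and K: "is_subfield K" and K_L: "K \<subseteq> L"
    and shift_K: "x \<in> K \<Longrightarrow> \<sigma> x \<in> K"
    and fixed_K: "x \<in> L \<Longrightarrow> \<sigma> x = x \<Longrightarrow> x \<in> K"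
begin

definition C :: "'a set" where
  "C = {x\<in>L. \<sigma> x = x}"

lemma is_subfield_C: "is_subfield C"
  using L is_subfield_fixed unfolding C_def is_subfield_def by auto

lemma C_K: "C \<subseteq> K"
  by (auto simp: C_def fixed_K)

lemma C_L: "C \<subseteq> L"
  by (auto simp: C_def)

lemma shift_C: "c \<in> C \<Longrightarrow> \<sigma> c = c"
  by (simp add: C_def)

text \<open>\<open>D g\<close> and \<open>D h\<close> solve the same homogeneous equation
  \<open>a * \<sigma> w = b * w\<close>, so their quotient \<open>e\<close> is fixed by \<sigma> and
  is a constant. Then \<open>h - e * g\<close> has formal derivative 0 and lies in
  \<open>M\<close>.\<close>

lemma eliminate_generator:
  assumes gen: "affine_generator \<sigma> M y a \<mu>" and sub: "K \<subseteq> M" "M \<subseteq> L" "y \<in> L" and b: "b \<in> M"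
    and g: "g \<in> field_adjoin M y" "\<sigma> g - b * g \<in> M"
    and h: "h \<in> field_adjoin M y" "\<sigma> h - b * h \<in> M"
  shows "\<exists>c\<in>C. \<exists>d\<in>C. (c \<noteq> 0 \<or> d \<noteq> 0) \<and> c * g + d * h \<in> M"
proof -
  interpret affine_generator \<sigma> M y a \<mu> by fact
  note C01 = subfield_0[OF is_subfield_C] subfield_1[OF is_subfield_C]
  let ?N = "field_adjoin M y"
  have N: "is_subfield ?N" "M \<subseteq> ?N" "?N \<subseteq> L"
    using is_subfield_field_adjoin[OF M] field_adjoin_base[OF M] field_adjoin_least[OF M L sub(2,3)] by auto
  have triv: ?thesis if "g \<in> M"
    using that C01 by (intro bexI[of _ 1] bexI[of _ 0]) auto
  show ?thesis
  proof (cases "y \<in> M")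
    case True
    hence "g \<in> M" using field_adjoin_least[OF M M] g by blast
    thus ?thesis by (rule triv)
  next
    case False
    then obtain D where D_N: "\<And>g. g \<in> ?N \<Longrightarrow> D g \<in> ?N"
      and D_0: "\<And>g. g \<in> ?N \<Longrightarrow> D g = 0 \<Longrightarrow> g \<in> M"
      and D_add: "\<And>g h. g \<in> ?N \<Longrightarrow> h \<in> ?N \<Longrightarrow> D (g + h) = D g + D h"
      and D_mult: "\<And>e g. e \<in> M \<Longrightarrow> g \<in> ?N \<Longrightarrow> D (e * g) = e * D g"
      and D_M: "\<And>e. e \<in> M \<Longrightarrow> D e = 0" and "D y = 1"
      and D_shift: "\<And>g. g \<in> ?N \<Longrightarrow> D (\<sigma> g) = a * \<sigma> (D g)"
    proof (rule linear_derivative_exists, goal_cases)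
      case (1 D)
      from 1(2-) show thesis by (rule 1(1)[of D])
    qed
    have key: "a * \<sigma> (D g) = b * D g" if "g \<in> ?N" "\<sigma> g - b * g \<in> M" for g
    proof -
      have "b * g \<in> ?N" using subfield_mult[OF N(1)] N(2) b that by blast
      hence "D (b * g + (\<sigma> g - b * g)) = D (b * g) + D (\<sigma> g - b * g)"
        using that N(2) by (intro D_add) auto
      hence "D (b * g + (\<sigma> g - b * g)) = b * D g"
        using D_mult[OF b that(1)] D_M[OF that(2)] by simp
      thus ?thesis using D_shift[OF that(1)] by simp
    qed
    show ?thesis
    proof (cases "D g = 0")
      case True
      thus ?thesis using triv[OF D_0[OF g(1)]] by simp
    next
      case nz: False
      define e where "e = D h / D g"
      \<comment> \<open>\<sigma> maps the nonzero \<open>D g\<close> to a nonzero element, so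
        \<open>b\<close> cannot vanish and cancels in the quotient below.\<close>
      have "b \<noteq> 0"
        using key[OF g] a(2) nz shift_eq_0_iff by (metis mult_eq_0_iff)
      have "\<sigma> (D h) = b * D h / a" "\<sigma> (D g) = b * D g / a"
        using key[OF g] key[OF h] a(2) by (metis nonzero_mult_div_cancel_left)+
      hence "\<sigma> e = e"
        using \<open>b \<noteq> 0\<close> a by (simp add: e_def shift_divide)
      moreover have "e \<in> L"
        unfolding e_def using N(3) D_N[OF g(1)] D_N[OF h(1)] by (intro subfield_divide[OF L]) auto
      ultimately have e: "e \<in> C" by (simp add: C_def)
      hence e': "- e \<in> C" by (rule subfield_uminus[OF is_subfield_C])
      hence eM: "- e \<in> M" using C_K sub by auto
      have mem: "- e * g \<in> ?N" using subfield_mult[OF N(1)] N(2) eM g(1) by blast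
      hence "D (- e * g + h) = 0"
        using D_add[OF mem h(1)] D_mult[OF eM g(1)] nz by (simp add: e_def)
      hence "- e * g + 1 * h \<in> M"
        using D_0 subfield_add[OF N(1) mem h(1)] by simp
      thus ?thesis using e' C01 by (intro bexI[of _ "- e"] bexI[of _ 1]) auto
    qed
  qed
qed

text \<open>A level must be stable under \<sigma> before the next generator can be adjoined;
  stability passes upwards by \<open>shift_field_adjoin\<close>.\<close>

lemma affine_generator_tower:
  assumes a: "a \<in> K" "a \<noteq> 0" and t: "\<And>i. \<sigma> (t i) - a * t i \<in> tower K t i"
  shows "affine_generator \<sigma> (tower K t n) (t n) a (\<sigma> (t n) - a * t n)"
proof (induction n)
  case 0
  show ?case
    using a t[of 0] by unfold_locales (auto simp: K shift_K)
next
  case (Suc n)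
  then interpret A: affine_generator \<sigma> "tower K t n" "t n" a "\<sigma> (t n) - a * t n" .
  show ?case
    using a t[of "Suc n"] is_subfield_tower[OF K, of t "Suc n"] tower_base[OF K, of t "Suc n"]
      A.shift_field_adjoin
    by unfold_locales auto
qed

text \<open>Consecutive members of the family are paired, and each pair is combined so as to lose
  the top generator. The combinations form another infinite family one level lower, so the induction
  reaches \<open>K\<close>.\<close>

lemma constant_combination_in_base:
  assumes a: "a \<in> K" "a \<noteq> 0" and t: "\<And>i. \<sigma> (t i) - a * t i \<in> tower K t i" "\<And>i. t i \<in> L"
    and b: "b \<in> K" and g: "\<And>i. g i \<in> tower K t n" "\<And>i. \<sigma> (g i) - b * g i \<in> K"
  shows "\<exists>m c. (\<forall>i. c i \<in> C) \<and> (\<exists>i<m::nat. c i \<noteq> 0) \<and> (\<Sum>i<m. c i * g i) \<in> K"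
  using g
proof (induction n arbitrary: g)
  case 0
  show ?case
    using 0(1)[of 0] subfield_1[OF is_subfield_C]
    by (intro exI[of _ "1::nat"] exI[of _ "\<lambda>_. 1"]) auto
next
  case (Suc n)
  let ?M = "tower K t n"
  have KM: "K \<subseteq> ?M" "?M \<subseteq> L"
    using tower_base[OF K] tower_subset[OF K L K_L] t by auto
  have "\<exists>c\<in>C. \<exists>d\<in>C. (c \<noteq> 0 \<or> d \<noteq> 0) \<and> c * g (2*i) + d * g (2*i+1) \<in> ?M" for i
  proof (rule eliminate_generator[OF affine_generator_tower[OF a t(1)] KM t(2) subsetD[OF KM(1) b]])
    show "g (2*i) \<in> field_adjoin ?M (t n)" "g (2*i+1) \<in> field_adjoin ?M (t n)"
      using Suc.prems(1) by simp_all
    show "\<sigma> (g (2*i)) - b * g (2*i) \<in> ?M" "\<sigma> (g (2*i+1)) - b * g (2*i+1) \<in> ?M"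
      using Suc.prems(2) KM by auto
  qed
  then obtain c d where cd: "\<And>i. c i \<in> C" "\<And>i. d i \<in> C" "\<And>i. c i \<noteq> 0 \<or> d i \<noteq> 0"
    "\<And>i. c i * g (2*i) + d i * g (2*i+1) \<in> ?M" by metis
  define h where "h i = c i * g (2*i) + d i * g (2*i+1)" for i
  have "\<sigma> (h i) - b * h i \<in> K" for i
  proof -
    have "\<sigma> (h i) - b * h i = c i * (\<sigma> (g (2*i)) - b * g (2*i)) + d i * (\<sigma> (g (2*i+1)) - b * g (2*i+1))"
      using cd by (simp add: h_def shift_simps shift_C algebra_simps)
    also have "\<dots> \<in> K"
      using cd C_K Suc.prems K by (intro subfield_add subfield_mult) auto
    finally show ?thesis .
  qed
  then obtain m e where e: "\<And>i. e i \<in> C" "\<exists>i<m. e i \<noteq> 0" "(\<Sum>i<m. e i * h i) \<in> K"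
  proof -
    assume "\<And>i. \<sigma> (h i) - b * h i \<in> K"
    moreover have "\<And>i. h i \<in> ?M" using cd(4) by (simp add: h_def)
    ultimately show thesis using Suc.IH[of h] that by blast
  qed
  \<comment> \<open>Coefficients with respect to the original family: \<open>e i\<close> times the
    two coefficients of the pair with index \<open>i\<close>. These are not both 0, so a nonzero
    \<open>e i\<close> leaves a nonzero entry.\<close>
  define f where "f k = e (k div 2) * (if even k then c (k div 2) else d (k div 2))" for k
  have "(\<Sum>k<2*m. f k * g k) = (\<Sum>i<m. e i * h i)"
    unfolding sum_lessThan_double by (rule sum.cong) (auto simp: f_def h_def algebra_simps)
  moreover have "\<exists>k<2*m. f k \<noteq> 0"
  proof -
    obtain i where "i < m" "e i \<noteq> 0" using e by blast
    hence "f (2*i) \<noteq> 0 \<or> f (2*i+1) \<noteq> 0" "2*i < 2*m" "2*i+1 < 2*m"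
      using cd(3)[of i] by (auto simp: f_def)
    thus ?thesis by blast
  qed
  moreover have "f k \<in> C" for k
    using e cd by (auto simp: f_def intro: subfield_mult[OF is_subfield_C])
  ultimately show ?case using e(3) by (intro exI[of _ "2*m"] exI[of _ f]) auto
qed

end

section \<open>Derivations and the tower of derivatives of a solution\<close>

locale derivation =
  fixes \<delta> :: "'a::field_char_0 \<Rightarrow> 'a"
  assumes deriv_add: "\<delta> (x + y) = \<delta> x + \<delta> y"
    and deriv_mult: "\<delta> (x * y) = x * \<delta> y + \<delta> x * y"
begin

lemma deriv_0: "\<delta> 0 = 0"
  using deriv_add[of 0 0] by simp

lemma deriv_1: "\<delta> 1 = 0"
  using deriv_mult[of 1 1] by simp

lemma deriv_of_nat: "\<delta> (of_nat n) = 0"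
  by (induction n) (auto simp: deriv_0 deriv_1 deriv_add)

lemma deriv_divide: "y \<noteq> 0 \<Longrightarrow> \<delta> (x / y) = (\<delta> x - x / y * \<delta> y) / y"
  using deriv_mult[of "x / y" y] by (simp add: eq_divide_eq)

lemma deriv_poly: "\<delta> (poly p x) = poly (map_poly \<delta> p) x + poly (pderiv p) x * \<delta> x"
  by (induction p) (auto simp: deriv_0 map_poly_pCons deriv_add deriv_mult pderiv_pCons algebra_simps)

text \<open>\<open>N\<close> is kept apart from the extension of \<open>M\<close> because
  differentiating one level of a tower leads into the next.\<close>

lemma deriv_field_adjoin:
  assumes M: "is_subfield M" and N: "is_subfield N" "M \<subseteq> N" "\<And>x. x \<in> M \<Longrightarrow> \<delta> x \<in> N"
    and t: "t \<in> N" "\<delta> t \<in> N" and g: "g \<in> field_adjoin M t"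
  shows "\<delta> g \<in> N"
proof -
  have poly: "poly p t \<in> N" "\<delta> (poly p t) \<in> N" if "coeffs_in M p" for p
  proof -
    have p: "coeffs_in N p" using that N by (rule_tac coeffs_in_mono)
    moreover have "coeffs_in N (map_poly \<delta> p)"
      using that N by (auto simp: coeffs_in_def coeff_map_poly deriv_0)
    ultimately show "poly p t \<in> N" "\<delta> (poly p t) \<in> N"
      unfolding deriv_poly using N t
      by (auto intro!: subfield_add subfield_mult subfield_poly coeffs_in_pderiv)
  qed
  obtain p r where pr: "coeffs_in M p" "coeffs_in M r" "poly r t \<noteq> 0" "g = poly p t / poly r t"
    using g by (rule field_adjoinE[OF M])
  show ?thesis
    unfolding pr(4) deriv_divide[OF pr(3)]
    using N(1) poly[OF pr(1)] poly[OF pr(2)] by (intro subfield_intros)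
qed

end

locale differential_difference_subfield =
  difference_subfield \<sigma> L K + derivation \<delta> for \<sigma> :: "'a::field_char_0 \<Rightarrow> 'a" and L K \<delta> +
  assumes deriv_shift: "\<delta> (\<sigma> x) = \<sigma> (\<delta> x)"
    and deriv_K: "x \<in> K \<Longrightarrow> \<delta> x \<in> K" and deriv_L: "x \<in> L \<Longrightarrow> \<delta> x \<in> L"
begin

context
  fixes z :: 'a
begin

abbreviation deriv_tower :: "nat \<Rightarrow> 'a set" where
  "deriv_tower n \<equiv> tower K (\<lambda>i. (\<delta> ^^ i) z) n"

lemma deriv_deriv_tower: "x \<in> deriv_tower n \<Longrightarrow> \<delta> x \<in> deriv_tower (Suc n)"
proof (induction n arbitrary: x)
  case 0
  thus ?case
    using deriv_K field_adjoin_base[OF K] by auto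
next
  case (Suc n)
  show ?case
  proof (rule deriv_field_adjoin)
    show "x \<in> field_adjoin (deriv_tower n) ((\<delta> ^^ n) z)"
      using Suc.prems by simp
    show "deriv_tower n \<subseteq> deriv_tower (Suc (Suc n))"
      by (rule tower_mono[OF K]) simp
    show "\<delta> x \<in> deriv_tower (Suc (Suc n))" if "x \<in> deriv_tower n" for x
      using Suc.IH[OF that] tower_Suc_mono[OF K] by blast
    show "(\<delta> ^^ n) z \<in> deriv_tower (Suc (Suc n))"
      by (rule tower_gen[OF K]) simp
    show "\<delta> ((\<delta> ^^ n) z) \<in> deriv_tower (Suc (Suc n))"
      using tower_gen[OF K, of "Suc n" "Suc (Suc n)" "\<lambda>i. (\<delta> ^^ i) z"] by simp
  qed (rule is_subfield_tower[OF K])+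
qed

lemma deriv_generator_L: "z \<in> L \<Longrightarrow> (\<delta> ^^ i) z \<in> L"
  by (induction i) (auto simp: deriv_L)

text \<open>Differentiating the minimal equation of the derivative of order \<open>n\<close> gives a
  linear equation for the next one. Its leading coefficient, a value of \<open>pderiv Q\<close>, is
  nonzero by minimality and characteristic 0.\<close>

lemma deriv_generator_algebraic:
  assumes "coeffs_in (deriv_tower n) P" "P \<noteq> 0" "poly P ((\<delta> ^^ n) z) = 0"
  shows "(\<delta> ^^ Suc n) z \<in> deriv_tower (Suc n)"
proof -
  let ?M = "deriv_tower n" and ?N = "deriv_tower (Suc n)" and ?y = "(\<delta> ^^ n) z"
  note M = is_subfield_tower[OF K, of "\<lambda>i. (\<delta> ^^ i) z" n]
  note N = is_subfield_tower[OF K, of "\<lambda>i. (\<delta> ^^ i) z" "Suc n"]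
  obtain Q where Q: "coeffs_in ?M Q" "Q \<noteq> 0" "poly Q ?y = 0"
    and min: "\<And>p. coeffs_in ?M p \<Longrightarrow> p \<noteq> 0 \<Longrightarrow> poly p ?y = 0 \<Longrightarrow> degree Q \<le> degree p"
  proof (rule minimal_annihilator[OF assms], goal_cases)
    case (1 Q)
    from 1(2-) show thesis by (rule 1(1))
  qed
  have "degree Q \<noteq> 0"
  proof
    assume "degree Q = 0"
    then obtain c where "Q = [:c:]" by (rule degree_eq_zeroE)
    thus False using Q by simp
  qed
  hence nz: "poly (pderiv Q) ?y \<noteq> 0"
    using min[of "pderiv Q"] Q M by (auto simp: coeffs_in_pderiv degree_pderiv pderiv_eq_0_iff)
  have "0 = \<delta> (poly Q ?y)" using Q by (simp add: deriv_0)
  also have "\<dots> = poly (map_poly \<delta> Q) ?y + poly (pderiv Q) ?y * (\<delta> ^^ Suc n) z"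
    by (simp add: deriv_poly)
  finally have eq: "(\<delta> ^^ Suc n) z = - poly (map_poly \<delta> Q) ?y / poly (pderiv Q) ?y"
    using nz by (metis add_eq_0_iff nonzero_mult_div_cancel_left)
  have "?y \<in> ?N" by (rule tower_gen[OF K]) simp
  moreover have "coeffs_in ?N (map_poly \<delta> Q)"
    using Q(1) deriv_deriv_tower[of _ n] by (auto simp: coeffs_in_def coeff_map_poly deriv_0)
  moreover have "coeffs_in ?N (pderiv Q)"
    using coeffs_in_mono[OF Q(1) tower_Suc_mono[OF K]] N by (intro coeffs_in_pderiv)
  ultimately show ?thesis
    unfolding eq using N by (intro subfield_divide subfield_uminus subfield_poly)
qed

text \<open>Level \<open>Suc n\<close> collapses into level \<open>n\<close>, which is therefore
  closed under \<delta>.\<close>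

lemma deriv_tower_stable:
  assumes "(\<delta> ^^ n) z \<in> deriv_tower n" "x \<in> deriv_tower n"
  shows "(\<delta> ^^ i) x \<in> deriv_tower n"
proof (induction i)
  case (Suc i)
  have "deriv_tower (Suc n) \<subseteq> deriv_tower n"
    using assms(1) is_subfield_tower[OF K, of "\<lambda>i. (\<delta> ^^ i) z" n]
    by (simp add: field_adjoin_least)
  thus ?case using deriv_deriv_tower[OF Suc] by auto
qed (use assms in simp)

context
  fixes a b
  assumes z: "z \<in> L" and a: "a \<in> K" "a \<noteq> 0" and b: "b \<in> K" and eq: "\<sigma> z = a * z + b"
begin

text \<open>These are the two leading terms of the Leibniz formula. The remainder involves
  derivatives of \<open>z\<close> of order below \<open>n\<close> only, so a formal derivative with
  respect to \<open>(\<delta> ^^ n) z\<close> kills it.\<close>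

lemma shift_deriv_generator:
  "\<sigma> ((\<delta> ^^ Suc n) z) - a * (\<delta> ^^ Suc n) z - of_nat (Suc n) * \<delta> a * (\<delta> ^^ n) z \<in> deriv_tower n"
proof (induction n)
  case 0
  have "\<sigma> (\<delta> z) = \<delta> (a * z + b)" by (simp add: eq flip: deriv_shift)
  hence "\<sigma> (\<delta> z) - a * \<delta> z - \<delta> a * z = \<delta> b"
    by (simp add: deriv_add deriv_mult)
  thus ?case using deriv_K[OF b] by simp
next
  case (Suc n)
  define \<rho> where "\<rho> = \<sigma> ((\<delta> ^^ Suc n) z) - a * (\<delta> ^^ Suc n) z - of_nat (Suc n) * \<delta> a * (\<delta> ^^ n) z"
  have "\<sigma> ((\<delta> ^^ Suc n) z) = a * (\<delta> ^^ Suc n) z + of_nat (Suc n) * \<delta> a * (\<delta> ^^ n) z + \<rho>"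
    by (simp add: \<rho>_def)
  hence "\<delta> (\<sigma> ((\<delta> ^^ Suc n) z)) =
      \<delta> (a * (\<delta> ^^ Suc n) z + of_nat (Suc n) * \<delta> a * (\<delta> ^^ n) z + \<rho>)"
    by (rule arg_cong)
  hence "\<sigma> ((\<delta> ^^ Suc (Suc n)) z) - a * (\<delta> ^^ Suc (Suc n)) z
        - of_nat (Suc (Suc n)) * \<delta> a * (\<delta> ^^ Suc n) z
      = of_nat (Suc n) * \<delta> (\<delta> a) * (\<delta> ^^ n) z + \<delta> \<rho>"
    by (simp add: deriv_shift deriv_add deriv_mult deriv_of_nat deriv_1 algebra_simps)
  also have "\<dots> \<in> deriv_tower (Suc n)"
  proof -
    note N = is_subfield_tower[OF K, of "\<lambda>i. (\<delta> ^^ i) z" "Suc n"]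
    have "\<delta> \<rho> \<in> deriv_tower (Suc n)"
      using Suc.IH deriv_deriv_tower unfolding \<rho>_def by blast
    moreover have "(\<delta> ^^ n) z \<in> deriv_tower (Suc n)" by (rule tower_gen[OF K]) simp
    moreover have "\<delta> (\<delta> a) \<in> deriv_tower (Suc n)"
      using tower_base[OF K] deriv_K[OF deriv_K[OF a(1)]] by blast
    ultimately show ?thesis
      using N by (intro subfield_add subfield_mult subfield_of_nat)
  qed
  finally show ?case .
qed

text \<open>The term with \<open>\<delta> a\<close> is absorbed in the remainder, which is the shape
  of equation that the tower lemmas ask for.\<close>

lemma shift_deriv_generator':
  "\<sigma> ((\<delta> ^^ n) z) - a * (\<delta> ^^ n) z \<in> deriv_tower n"
proof (cases n)
  case 0
  thus ?thesis using eq b by simp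
next
  case (Suc m)
  note N = is_subfield_tower[OF K, of "\<lambda>i. (\<delta> ^^ i) z" n]
  have "of_nat (Suc m) * \<delta> a * (\<delta> ^^ m) z \<in> deriv_tower n"
    using N tower_base[OF K, of "\<lambda>i. (\<delta> ^^ i) z" n] deriv_K[OF a(1)]
      tower_gen[OF K, of m n "\<lambda>i. (\<delta> ^^ i) z"] Suc
    by (intro subfield_mult[OF N] subfield_of_nat[OF N]) auto
  moreover have "\<sigma> ((\<delta> ^^ n) z) - a * (\<delta> ^^ n) z - of_nat (Suc m) * \<delta> a * (\<delta> ^^ m) z \<in> deriv_tower n"
    using shift_deriv_generator[of m] tower_Suc_mono[OF K] unfolding Suc by blast
  ultimately show ?thesis
    using subfield_add[OF N] by fastforce
qed

lemma deriv_combination_additive: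
  assumes z_K: "z \<notin> K" and alg: "(\<delta> ^^ n) z \<in> deriv_tower n"
  shows "\<exists>g\<in>L. \<sigma> g = g + \<delta> a / a \<and>
    (\<exists>m c. (\<forall>i. c i \<in> C) \<and> (\<exists>i<m. c i \<noteq> 0) \<and> (\<Sum>i<m. c i * (\<delta> ^^ i) g) \<in> K)"
proof -
  \<comment> \<open>Minimality of \<open>n\<close> keeps the preceding derivative outside its own
    level, so a formal derivative with respect to it exists.\<close>
  obtain n where n: "(\<delta> ^^ n) z \<in> deriv_tower n" and least: "\<And>i. i < n \<Longrightarrow> (\<delta> ^^ i) z \<notin> deriv_tower i"
    using alg exists_least_iff[of "\<lambda>n. (\<delta> ^^ n) z \<in> deriv_tower n"] by blast
  have "n \<noteq> 0" using n z_K by (metis funpow_0 tower.simps(1))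
  then obtain j where j: "n = Suc j" by (cases n) auto
  let ?M = "deriv_tower j" and ?y = "(\<delta> ^^ j) z" and ?x = "(\<delta> ^^ Suc j) z"
  note aK = a
  interpret affine_generator \<sigma> ?M ?y a "\<sigma> ?y - a * ?y"
    by (rule affine_generator_tower[of a "\<lambda>i. (\<delta> ^^ i) z", OF a shift_deriv_generator'])
  let ?N = "field_adjoin ?M ?y"
  have N: "is_subfield ?N" "?M \<subseteq> ?N"
    using is_subfield_field_adjoin[OF M] field_adjoin_base[OF M] by auto
  have N_L: "?N \<subseteq> L"
    using tower_subset[OF K L K_L, of n "\<lambda>i. (\<delta> ^^ i) z"] deriv_generator_L[OF z] j by simp
  define u where "u = of_nat (Suc j) * \<delta> a"
  have "?y \<notin> ?M" using least[of j] j by simp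
  moreover have "u \<in> ?M"
    unfolding u_def using deriv_K[OF aK(1)] tower_base[OF K] M
    by (intro subfield_mult subfield_of_nat) auto
  moreover have "\<sigma> ?x - a * ?x - u * ?y \<in> ?M"
    unfolding u_def by (rule shift_deriv_generator)
  moreover have "?x \<in> ?N" using n j by simp
  ultimately obtain h where h: "h \<in> ?N" and shift_h: "\<sigma> h = h + u / a"
    using additive_equation_from_derivative by blast
  \<comment> \<open>\<open>u\<close> carries the Leibniz factor \<open>Suc j\<close>; dividing by it
    normalises the inhomogeneity to \<open>\<delta> a / a\<close>.\<close>
  define g where "g = h / of_nat (Suc j)"
  have "\<sigma> g = g + \<delta> a / a"
    unfolding g_def shift_divide shift_of_nat shift_h u_def
    by (simp add: add_divide_distrib del: of_nat_Suc)
  moreover have g: "g \<in> ?N"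
    unfolding g_def using N h by (intro subfield_divide subfield_of_nat)
  \<comment> \<open>The generators of the tower have multiplier \<open>a\<close>, whereas the
    derivatives of \<open>g\<close> satisfy equations with multiplier 1. All of them lie in the
    level \<open>n\<close>, which is closed under \<delta>.\<close>
  moreover have "\<exists>m c. (\<forall>i. c i \<in> C) \<and> (\<exists>i<m. c i \<noteq> 0) \<and> (\<Sum>i<m. c i * (\<delta> ^^ i) g) \<in> K"
  proof (rule constant_combination_in_base[OF aK shift_deriv_generator' deriv_generator_L[OF z]])
    show "1 \<in> K" by (rule subfield_1[OF K])
    show "(\<delta> ^^ i) g \<in> deriv_tower n" for i
      using deriv_tower_stable[OF n] g j by simp
    have "(\<delta> ^^ i) (\<delta> a / a) \<in> K \<and> \<sigma> ((\<delta> ^^ i) g) = (\<delta> ^^ i) g + (\<delta> ^^ i) (\<delta> a / a)" for i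
    proof (induction i)
      case 0
      show ?case
        using \<open>\<sigma> g = _\<close> K aK by (auto intro: subfield_divide deriv_K)
    next
      case (Suc i)
      thus ?case by (simp add: deriv_K deriv_add flip: deriv_shift)
    qed
    thus "\<sigma> ((\<delta> ^^ i) g) - 1 * (\<delta> ^^ i) g \<in> K" for i by simp
  qed
  ultimately show ?thesis using N_L by blast
qed

text \<open>When \<open>\<delta> a = 0\<close>, differentiation keeps the multiplier, so all
  derivatives of \<open>z\<close> satisfy equations with the same \<open>a\<close>.\<close>

lemma deriv_combination_constant:
  assumes \<delta>a: "\<delta> a = 0" and alg: "(\<delta> ^^ n) z \<in> deriv_tower n"
  shows "\<exists>m c. (\<forall>i. c i \<in> C) \<and> (\<exists>i<m. c i \<noteq> 0) \<and> (\<Sum>i<m. c i * (\<delta> ^^ i) z) \<in> K"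
proof (rule constant_combination_in_base[OF a shift_deriv_generator' deriv_generator_L[OF z] a(1)])
  \<comment> \<open>Level \<open>Suc n\<close> is taken so that it contains \<open>z\<close> even
    for \<open>n = 0\<close>.\<close>
  show "(\<delta> ^^ i) z \<in> deriv_tower (Suc n)" for i
  proof (rule deriv_tower_stable)
    show "z \<in> deriv_tower (Suc n)"
      using tower_gen[OF K, of 0 "Suc n" "\<lambda>i. (\<delta> ^^ i) z"] by simp
    show "(\<delta> ^^ Suc n) z \<in> deriv_tower (Suc n)"
      using deriv_deriv_tower[OF alg] by simp
  qed
  have "(\<delta> ^^ i) b \<in> K \<and> \<sigma> ((\<delta> ^^ i) z) = a * (\<delta> ^^ i) z + (\<delta> ^^ i) b" for i
    by (induction i) (auto simp: b eq deriv_K deriv_add deriv_mult \<delta>a simp flip: deriv_shift)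
  thus "\<sigma> ((\<delta> ^^ i) z) - a * (\<delta> ^^ i) z \<in> K" for i by simp
qed

end

end

end

section \<open>Transcendence and descent of constants\<close>

text \<open>Read as a polynomial in the last generator, the sum vanishes coefficient by coefficient,
  and each coefficient is a relation among monomials in fewer generators.\<close>

lemma tower_monomials_independent:
  assumes K: "is_subfield K"
    and tr: "\<And>i p. i < n \<Longrightarrow> coeffs_in (tower K t i) p \<Longrightarrow> poly p (t i) = 0 \<Longrightarrow> p = 0"
    and S: "finite S" "\<And>s s'. s \<in> S \<Longrightarrow> s' \<in> S \<Longrightarrow> (\<And>i. i < n \<Longrightarrow> m s i = m s' i) \<Longrightarrow> s = s'"
    and e: "\<And>s. s \<in> S \<Longrightarrow> e s \<in> K" and eq: "(\<Sum>s\<in>S. e s * (\<Prod>i<n. t i ^ m s i)) = 0"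
    and s: "s \<in> S"
  shows "e s = 0"
  using tr S e eq s
proof (induction n arbitrary: S)
  case 0
  have "s' = s" if "s' \<in> S" for s'
    by (rule 0(3)[OF that 0(6)]) simp
  hence "S = {s}" using 0(6) by blast
  thus ?case using 0(5) by simp
next
  case (Suc n)
  define p where "p = (\<Sum>s\<in>S. monom (e s * (\<Prod>i<n. t i ^ m s i)) (m s n))"
  have "coeffs_in (tower K t n) p"
    unfolding p_def
    using is_subfield_tower[OF K, of t n] Suc.prems(4) tower_base[OF K, of t n] tower_gen[OF K, of _ n t]
    by (intro coeffs_in_sum coeffs_in_monom subfield_mult subfield_prod subfield_power) auto
  moreover have "poly p (t n) = 0"
    using Suc.prems(5) by (simp add: p_def poly_sum poly_monom mult.assoc)
  ultimately have "p = 0" using Suc.prems(1)[of n p] by simp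
  hence "coeff p (m s n) = 0" by simp
  moreover have "coeff p (m s n) = (\<Sum>s'\<in>{s'\<in>S. m s' n = m s n}. e s' * (\<Prod>i<n. t i ^ m s' i))"
    unfolding p_def coeff_sum coeff_monom using Suc.prems(2) by (simp add: sum.If_cases Int_def)
  ultimately have eq0: "(\<Sum>s'\<in>{s'\<in>S. m s' n = m s n}. e s' * (\<Prod>i<n. t i ^ m s' i)) = 0" by simp
  show ?case
  proof (rule Suc.IH[OF _ _ _ _ eq0])
    show "u = u'" if "u \<in> {s'\<in>S. m s' n = m s n}" "u' \<in> {s'\<in>S. m s' n = m s n}"
      "\<And>i. i < n \<Longrightarrow> m u i = m u' i" for u u'
      using that by (intro Suc.prems(3)) (auto simp: less_Suc_eq)
    show "p = 0" if "i < n" "coeffs_in (tower K t i) p" "poly p (t i) = 0" for i p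
      using Suc.prems(1)[of i p] that by simp
  qed (use Suc.prems in auto)
qed

context difference_subfield
begin

text \<open>Linear disjointness of \<open>L\<close> and the fixed field of \<open>\<sigma>\<close> over their intersection: divide a
  relation by one of its members and apply \<open>\<sigma> - 1\<close> to shorten it.\<close>

lemma relation_over_constants:
  assumes shift_L: "\<And>x. x \<in> L \<Longrightarrow> \<sigma> x \<in> L"
    and I: "finite I" and g: "\<And>i. i \<in> I \<Longrightarrow> \<sigma> (g i) = g i" and s: "\<And>i. i \<in> I \<Longrightarrow> s i \<in> L"
    and eq: "(\<Sum>i\<in>I. g i * s i) = 0" and nz: "\<exists>i\<in>I. g i \<noteq> 0"
  shows "\<exists>c. (\<forall>i. c i \<in> C) \<and> (\<exists>i\<in>I. c i \<noteq> 0) \<and> (\<Sum>i\<in>I. c i * s i) = 0"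
  using I g s eq nz
proof (induction I arbitrary: s rule: finite_induct)
  case empty
  thus ?case by simp
next
  case (insert k I)
  note C01 = subfield_0[OF is_subfield_C] subfield_1[OF is_subfield_C]
  show ?case
  proof (cases "s k = 0")
    case True
    have "(\<Sum>i\<in>I. (if i = k then 1 else 0) * s i) = 0"
      using insert.hyps by (intro sum.neutral) auto
    thus ?thesis
      using True C01 insert.hyps by (intro exI[of _ "\<lambda>i. if i = k then 1 else 0"]) auto
  next
    case sk: False
    define s' where "s' i = s i / s k" for i
    define u where "u i = \<sigma> (s' i) - s' i" for i
    have s'_L: "s' i \<in> L" if "i \<in> insert k I" for i
      unfolding s'_def using insert.prems(2) that by (intro subfield_divide[OF L]) auto
    have u_L: "u i \<in> L" if "i \<in> I" for i
      unfolding u_def using s'_L that shift_L by (intro subfield_diff[OF L]) auto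
    have sum0: "(\<Sum>i\<in>I. g i * s' i) = - g k"
    proof -
      have "(\<Sum>i\<in>insert k I. g i * s i) / s k = 0" using insert.prems(3) by simp
      thus ?thesis
        using insert.hyps sk
        by (simp add: s'_def sum_divide_distrib add_divide_distrib add_eq_0_iff)
    qed
    have "\<sigma> (\<Sum>i\<in>I. g i * s' i) = (\<Sum>i\<in>I. g i * \<sigma> (s' i))"
      using insert.prems(1) by (simp add: shift_simps)
    hence "(\<Sum>i\<in>I. g i * \<sigma> (s' i)) = - g k"
      using sum0 insert.prems(1) by (simp add: shift_simps)
    hence sum_u: "(\<Sum>i\<in>I. g i * u i) = 0"
      using sum0 by (simp add: u_def right_diff_distrib sum_subtractf)
    have "\<exists>i\<in>I. g i \<noteq> 0"
    proof (rule ccontr)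
      assume "\<not> (\<exists>i\<in>I. g i \<noteq> 0)"
      hence "(\<Sum>i\<in>I. g i * s' i) = 0" "\<forall>i\<in>I. g i = 0" by simp_all
      thus False using sum0 insert.prems(4) by auto
    qed
    then obtain c where c: "\<And>i. c i \<in> C" "\<exists>i\<in>I. c i \<noteq> 0" "(\<Sum>i\<in>I. c i * u i) = 0"
      using insert.IH[of u] u_L sum_u insert.prems(1) by auto
    \<comment> \<open>The shortened relation says that \<open>d\<close> is fixed by \<sigma>; its
      negative is the constant still missing at \<open>k\<close>.\<close>
    define d where "d = (\<Sum>i\<in>I. c i * s' i)"
    have "\<sigma> d - d = (\<Sum>i\<in>I. c i * u i)"
      using c by (simp add: d_def u_def shift_simps shift_C right_diff_distrib sum_subtractf)
    hence "\<sigma> d = d" using c by simp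
    moreover have "d \<in> L"
      unfolding d_def using c C_L s'_L by (intro subfield_sum[OF L] subfield_mult[OF L]) auto
    ultimately have d: "- d \<in> C"
      by (intro subfield_uminus[OF is_subfield_C]) (simp add: C_def)
    define c' where "c' = c(k := - d)"
    have "(\<Sum>i\<in>I. c' i * s i) = (\<Sum>i\<in>I. c i * s i)"
      using insert.hyps by (intro sum.cong) (auto simp: c'_def)
    also have "\<dots> = d * s k"
      using sk by (simp add: d_def s'_def sum_distrib_right)
    finally have "(\<Sum>i\<in>insert k I. c' i * s i) = 0"
      using insert.hyps by (simp add: c'_def)
    moreover have "\<exists>i\<in>insert k I. c' i \<noteq> 0"
      using c(2) insert.hyps by (auto simp: c'_def)
    moreover have "c' i \<in> C" for i
      using c d by (auto simp: c'_def)
    ultimately show ?thesis by blast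
  qed
qed

end

text \<open>After clearing denominators the differential equation is a linear relation, with
  coefficients fixed by \<sigma>, among the elements \<open>x ^ j * \<mu> m\<close> of
  \<open>L\<close>; these coefficients can be replaced by constants. This gives a relation over
  \<open>K\<close> among monomials in the derivatives, so some derivative is algebraic over its
  level.\<close>

lemma (in differential_difference_subfield) diff_algebraic_imp_in_deriv_tower:
  assumes shift_L: "\<And>x. x \<in> L \<Longrightarrow> \<sigma> x \<in> L" and z: "z \<in> L" and x: "x \<in> K"
    and tr: "\<And>p. coeffs_in C p \<Longrightarrow> poly p x = 0 \<Longrightarrow> p = 0"
    and alg: "diff_algebraic_over \<delta> (field_adjoin {x. \<sigma> x = x} x) z"
  shows "\<exists>n. (\<delta> ^^ n) z \<in> deriv_tower z n"
proof -
  define k0 where "k0 = {x. \<sigma> x = x}"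
  have F: "is_subfield k0" unfolding k0_def by (rule is_subfield_fixed)
  let ?zs = "\<lambda>i. (\<delta> ^^ i) z"
  obtain P where P: "P \<noteq> 0" "\<And>m. Poly_Mapping.lookup P m \<in> field_adjoin k0 x"
    "diff_poly_eval \<delta> P z = 0"
    using alg by (auto simp: diff_algebraic_over_def k0_def)
  let ?S = "Poly_Mapping.keys P"
  have "\<exists>p r. coeffs_in k0 p \<and> coeffs_in k0 r \<and> poly r x \<noteq> 0 \<and>
      Poly_Mapping.lookup P m = poly p x / poly r x" for m
    using P(2)[of m] unfolding field_adjoin_iff[OF F] .
  then obtain p r where pr: "\<And>m. coeffs_in k0 (p m)" "\<And>m. coeffs_in k0 (r m)"
    "\<And>m. poly (r m) x \<noteq> 0" "\<And>m. Poly_Mapping.lookup P m = poly (p m) x / poly (r m) x"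
    by metis
  obtain n where n: "\<And>m i. m \<in> ?S \<Longrightarrow> i \<in> Poly_Mapping.keys m \<Longrightarrow> i < n"
  proof -
    have "finite (\<Union>m\<in>?S. Poly_Mapping.keys m)" by simp
    then obtain n where "(\<Union>m\<in>?S. Poly_Mapping.keys m) \<subseteq> {..<n}"
      by (metis finite_nat_iff_bounded)
    thus thesis by (intro that[of n]) auto
  qed
  define \<mu> where "\<mu> m = (\<Prod>i<n. ?zs i ^ Poly_Mapping.lookup m i)" for m
  have \<mu>: "(\<Prod>i\<in>Poly_Mapping.keys m. ?zs i ^ Poly_Mapping.lookup m i) = \<mu> m" if "m \<in> ?S" for m
    unfolding \<mu>_def using n[OF that] by (intro prod.mono_neutral_left) (auto simp: in_keys_iff)
  have eq0: "(\<Sum>m\<in>?S. poly (p m) x / poly (r m) x * \<mu> m) = 0"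
    using P(3) by (simp add: diff_poly_eval_def pr(4) \<mu> cong: sum.cong)
  \<comment> \<open>The numerators over the common denominator of all coefficients.\<close>
  define p' where "p' m = p m * (\<Prod>m'\<in>?S - {m}. r m')" for m
  have p'_eq: "poly (p' m) x = poly (\<Prod>m\<in>?S. r m) x * (poly (p m) x / poly (r m) x)" if "m \<in> ?S" for m
    using that pr(3)[of m] by (simp add: p'_def poly_prod prod.remove[of ?S m])
  have p'_C: "coeffs_in k0 (p' m)" for m
    unfolding p'_def using pr by (intro coeffs_in_mult[OF F] coeffs_in_prod[OF F])
  have p'_nz: "p' m \<noteq> 0" if "m \<in> ?S" for m
  proof -
    have "poly (\<Prod>m\<in>?S. r m) x \<noteq> 0" using pr(3) by (simp add: poly_prod)
    moreover have "poly (p m) x / poly (r m) x \<noteq> 0"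
      using that pr(4)[of m] by (metis in_keys_iff)
    ultimately show ?thesis using p'_eq[OF that] by (metis mult_eq_0_iff poly_0)
  qed
  have "(\<Sum>m\<in>?S. poly (p' m) x * \<mu> m)
      = poly (\<Prod>m\<in>?S. r m) x * (\<Sum>m\<in>?S. poly (p m) x / poly (r m) x * \<mu> m)"
    unfolding sum_distrib_left by (rule sum.cong) (simp_all add: p'_eq)
  hence eq1: "(\<Sum>m\<in>?S. poly (p' m) x * \<mu> m) = 0" using eq0 by simp
  obtain d where d: "\<And>m. m \<in> ?S \<Longrightarrow> degree (p' m) \<le> d"
    using finite_imageI[OF finite_keys[of P], of "\<lambda>m. degree (p' m)"]
    by (metis (no_types, lifting) finite_nat_set_iff_bounded_le imageI)
  have poly_p': "poly (p' m) x = (\<Sum>j\<le>d. coeff (p' m) j * x ^ j)" if "m \<in> ?S" for m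
    unfolding poly_altdef using d[OF that]
    by (intro sum.mono_neutral_left) (auto simp: coeff_eq_0)
  have eq2: "(\<Sum>(m, j)\<in>?S \<times> {..d}. coeff (p' m) j * (x ^ j * \<mu> m)) = 0"
  proof -
    have "(\<Sum>(m, j)\<in>?S \<times> {..d}. coeff (p' m) j * (x ^ j * \<mu> m))
        = (\<Sum>m\<in>?S. poly (p' m) x * \<mu> m)"
      unfolding sum.cartesian_product[symmetric]
      by (rule sum.cong) (simp_all add: poly_p' sum_distrib_right mult.assoc)
    thus ?thesis using eq1 by simp
  qed
  have \<mu>_L: "\<mu> m \<in> L" for m
    unfolding \<mu>_def by (intro subfield_prod[OF L] subfield_power[OF L] deriv_generator_L z)
  obtain m0 where m0: "m0 \<in> ?S"
    using P(1) by (metis all_not_in_conv keys_eq_empty)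
  have "\<exists>c. (\<forall>i. c i \<in> C) \<and> (\<exists>i\<in>?S \<times> {..d}. c i \<noteq> 0) \<and>
      (\<Sum>i\<in>?S \<times> {..d}. c i * (case i of (m, j) \<Rightarrow> x ^ j * \<mu> m)) = 0"
  proof (rule relation_over_constants[OF shift_L, where g = "\<lambda>(m, j). coeff (p' m) j"])
    show "(case i of (m, j) \<Rightarrow> x ^ j * \<mu> m) \<in> L" for i
      using x K_L \<mu>_L by (auto split: prod.splits intro!: subfield_mult[OF L] subfield_power[OF L])
    show "\<sigma> (case i of (m, j) \<Rightarrow> coeff (p' m) j) = (case i of (m, j) \<Rightarrow> coeff (p' m) j)" for i
      using p'_C by (auto simp: coeffs_in_def k0_def split: prod.splits)
    show "\<exists>i\<in>?S \<times> {..d}. (case i of (m, j) \<Rightarrow> coeff (p' m) j) \<noteq> 0"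
      using m0 p'_nz[OF m0] d[OF m0] by (intro bexI[of _ "(m0, degree (p' m0))"]) auto
    show "(\<Sum>i\<in>?S \<times> {..d}. (case i of (m, j) \<Rightarrow> coeff (p' m) j) * (case i of (m, j) \<Rightarrow> x ^ j * \<mu> m)) = 0"
      using eq2 by (simp add: case_prod_unfold)
  qed auto
  then obtain c where c: "\<And>i. c i \<in> C" "\<exists>i\<in>?S \<times> {..d}. c i \<noteq> 0"
    "(\<Sum>i\<in>?S \<times> {..d}. c i * (case i of (m, j) \<Rightarrow> x ^ j * \<mu> m)) = 0" by blast
  then obtain m1 j1 where m1: "m1 \<in> ?S" "j1 \<le> d" "c (m1, j1) \<noteq> 0" by auto
  \<comment> \<open>The constants are collected into polynomials in \<open>x\<close> again.
    Transcendence of \<open>x\<close> over the constants keeps one of their values nonzero.\<close>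
  define w where "w m = (\<Sum>j\<le>d. monom (c (m, j)) j)" for m
  have w_C: "coeffs_in C (w m)" for m
    unfolding w_def using c(1) by (intro coeffs_in_sum[OF is_subfield_C] coeffs_in_monom[OF is_subfield_C])
  have "coeff (w m1) j1 \<noteq> 0"
    using m1 by (simp add: w_def coeff_sum)
  hence "w m1 \<noteq> 0" by auto
  hence w_nz: "poly (w m1) x \<noteq> 0" using tr[OF w_C] by blast
  have eq3: "(\<Sum>m\<in>?S. poly (w m) x * \<mu> m) = 0"
  proof -
    have "(\<Sum>m\<in>?S. poly (w m) x * \<mu> m)
        = (\<Sum>m\<in>?S. \<Sum>j\<le>d. c (m, j) * (x ^ j * \<mu> m))"
      by (rule sum.cong) (simp_all add: w_def poly_sum poly_monom sum_distrib_right mult.assoc)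
    also have "\<dots> = (\<Sum>i\<in>?S \<times> {..d}. c i * (case i of (m, j) \<Rightarrow> x ^ j * \<mu> m))"
      unfolding sum.cartesian_product by (rule sum.cong) auto
    finally show ?thesis using c(3) by simp
  qed
  have w_K: "poly (w m) x \<in> K" for m
    by (rule subfield_poly[OF K coeffs_in_mono[OF w_C C_K] x])
  \<comment> \<open>If every derivative were transcendental over its level, the monomials would be
    independent over \<open>K\<close>, against the nonzero coefficient at \<open>m1\<close>.\<close>
  have "\<exists>i q. coeffs_in (deriv_tower z i) q \<and> q \<noteq> 0 \<and> poly q (?zs i) = 0"
  proof (rule ccontr)
    assume *: "\<nexists>i q. coeffs_in (deriv_tower z i) q \<and> q \<noteq> 0 \<and> poly q (?zs i) = 0"
    have "poly (w m1) x = 0"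
    proof (rule tower_monomials_independent[OF K, where n = n and t = ?zs and m = Poly_Mapping.lookup])
      show "finite ?S" "m1 \<in> ?S" using m1 by simp_all
      show "q = 0" if "coeffs_in (deriv_tower z i) q" "poly q (?zs i) = 0" for i q
        using * that by blast
      show "s = s'" if "s \<in> ?S" "s' \<in> ?S" "\<And>i. i < n \<Longrightarrow> Poly_Mapping.lookup s i = Poly_Mapping.lookup s' i"
        for s s'
      proof (rule poly_mapping_eqI)
        fix i show "Poly_Mapping.lookup s i = Poly_Mapping.lookup s' i"
          using that(3)[of i] n[OF that(1), of i] n[OF that(2), of i] by (metis in_keys_iff)
      qed
      show "(\<Sum>m\<in>?S. poly (w m) x * (\<Prod>i<n. ?zs i ^ Poly_Mapping.lookup m i)) = 0"
        using eq3 by (simp add: \<mu>_def)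
    qed (rule w_K)
    thus False using w_nz by simp
  qed
  thus ?thesis using deriv_generator_algebraic by blast
qed

section \<open>Laurent expansions of meromorphic functions\<close>

text \<open>A relation and not a function: at \<open>\<alpha> = 0\<close> there may be an essential
  singularity or an accumulation of poles, and then no expansion exists.\<close>

definition mero_expansion :: "complex \<Rightarrow> mero \<Rightarrow> complex fls \<Rightarrow> bool" where
  "mero_expansion \<alpha> g F \<longleftrightarrow> (\<exists>f. f meromorphic_on (-{0}) \<and> g = abs_mero f \<and>
     (\<lambda>w. f (\<alpha> + w)) has_laurent_expansion F)"

lemma mero_rel_refl_iff: "mero_rel f f \<longleftrightarrow> f meromorphic_on (-{0})"
  by (auto simp: mero_rel_def)

lemma mero_cases:
  obtains f where "f meromorphic_on (-{0})" "g = abs_mero f"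
  by (induction g rule: mero.abs_induct) (auto simp: mero_rel_refl_iff)

section \<open>Expansions under the field operations, the derivative and the shift\<close>

lemma mero_expansion_const: "mero_expansion \<alpha> (mero_const c) (fls_const c)"
  unfolding mero_expansion_def
  by (intro exI[of _ "\<lambda>_. c"]) (auto simp: mero_const.abs_eq)

lemma mero_expansion_X: "mero_expansion \<alpha> mero_X (fls_const \<alpha> + fls_X)"
  unfolding mero_expansion_def
  by (intro exI[of _ "\<lambda>x. x"]) (auto simp: mero_X_def intro!: laurent_expansion_intros)

lemma mero_expansion_0: "mero_expansion \<alpha> 0 0"
  unfolding mero_expansion_def
  by (intro exI[of _ "\<lambda>_. 0"]) (auto simp: zero_mero.abs_eq)

lemma mero_expansion_1: "mero_expansion \<alpha> 1 1"
  unfolding mero_expansion_def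
  by (intro exI[of _ "\<lambda>_. 1"]) (auto simp: one_mero.abs_eq)

lemma mero_expansion_add:
  assumes "mero_expansion \<alpha> g F" "mero_expansion \<alpha> h G"
  shows "mero_expansion \<alpha> (g + h) (F + G)"
proof -
  obtain u v where "u meromorphic_on (-{0})" "g = abs_mero u" "(\<lambda>w. u (\<alpha> + w)) has_laurent_expansion F"
    "v meromorphic_on (-{0})" "h = abs_mero v" "(\<lambda>w. v (\<alpha> + w)) has_laurent_expansion G"
    using assms unfolding mero_expansion_def by blast
  thus ?thesis unfolding mero_expansion_def
    by (intro exI[of _ "\<lambda>x. u x + v x"])
       (auto simp: plus_mero.abs_eq mero_rel_refl_iff intro!: meromorphic_intros laurent_expansion_intros)
qed

lemma mero_expansion_mult:
  assumes "mero_expansion \<alpha> g F" "mero_expansion \<alpha> h G"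
  shows "mero_expansion \<alpha> (g * h) (F * G)"
proof -
  obtain u v where "u meromorphic_on (-{0})" "g = abs_mero u" "(\<lambda>w. u (\<alpha> + w)) has_laurent_expansion F"
    "v meromorphic_on (-{0})" "h = abs_mero v" "(\<lambda>w. v (\<alpha> + w)) has_laurent_expansion G"
    using assms unfolding mero_expansion_def by blast
  thus ?thesis unfolding mero_expansion_def
    by (intro exI[of _ "\<lambda>x. u x * v x"])
       (auto simp: times_mero.abs_eq mero_rel_refl_iff intro!: meromorphic_intros laurent_expansion_intros)
qed

lemma mero_expansion_inverse:
  assumes "mero_expansion \<alpha> g F"
  shows "mero_expansion \<alpha> (inverse g) (inverse F)"
proof -
  obtain u where "u meromorphic_on (-{0})" "g = abs_mero u" "(\<lambda>w. u (\<alpha> + w)) has_laurent_expansion F"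
    using assms unfolding mero_expansion_def by blast
  thus ?thesis unfolding mero_expansion_def
    by (intro exI[of _ "\<lambda>x. inverse (u x)"])
       (auto simp: inverse_mero.abs_eq mero_rel_refl_iff intro!: meromorphic_intros laurent_expansion_intros)
qed

lemma mero_const_minus_1: "mero_const (-1) = -1"
  by transfer (simp add: mero_rel_def meromorphic_on_const)

lemma mero_expansion_uminus:
  assumes "mero_expansion \<alpha> g F"
  shows "mero_expansion \<alpha> (- g) (- F)"
  using mero_expansion_mult[OF mero_expansion_const[of \<alpha> "-1"] assms]
  by (simp add: mero_const_minus_1)

lemma mero_expansion_diff:
  "mero_expansion \<alpha> g F \<Longrightarrow> mero_expansion \<alpha> h G \<Longrightarrow> mero_expansion \<alpha> (g - h) (F - G)"
  using mero_expansion_add[of \<alpha> g F "- h" "- G"] mero_expansion_uminus[of \<alpha> h G] by simp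

lemma mero_expansion_divide:
  "mero_expansion \<alpha> g F \<Longrightarrow> mero_expansion \<alpha> h G \<Longrightarrow> mero_expansion \<alpha> (g / h) (F / G)"
  unfolding divide_inverse by (intro mero_expansion_mult mero_expansion_inverse)

lemma mero_expansion_sum:
  "(\<And>i. i \<in> I \<Longrightarrow> mero_expansion \<alpha> (g i) (F i)) \<Longrightarrow> mero_expansion \<alpha> (sum g I) (sum F I)"
  by (induction I rule: infinite_finite_induct) (auto intro: mero_expansion_0 mero_expansion_add)

lemma mero_expansion_power: "mero_expansion \<alpha> g F \<Longrightarrow> mero_expansion \<alpha> (g ^ n) (F ^ n)"
  by (induction n) (auto intro: mero_expansion_1 mero_expansion_mult)

lemma mero_expansion_power_int: "mero_expansion \<alpha> g F \<Longrightarrow> mero_expansion \<alpha> (g powi n) (F powi n)"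
  by (auto simp: power_int_def intro: mero_expansion_power mero_expansion_inverse)

lemma mero_expansion_euler_deriv:
  assumes "mero_expansion \<alpha> g F"
  shows "mero_expansion \<alpha> (euler_deriv g) ((fls_const \<alpha> + fls_X) * fls_deriv F)"
proof -
  obtain u where u: "u meromorphic_on (-{0})" "g = abs_mero u" "(\<lambda>w. u (\<alpha> + w)) has_laurent_expansion F"
    using assms unfolding mero_expansion_def by blast
  have "deriv (\<lambda>w. u (\<alpha> + w)) = (\<lambda>w. deriv u (\<alpha> + w))"
    by (rule ext, subst (1 2) deriv_shift_0) (simp add: o_def add_ac)
  hence "(\<lambda>w. deriv u (\<alpha> + w)) has_laurent_expansion fls_deriv F"
    using has_laurent_expansion_deriv[OF u(3)] by simp
  thus ?thesis unfolding mero_expansion_def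
    using u by (intro exI[of _ "\<lambda>x. x * deriv u x"])
       (auto simp: euler_deriv.abs_eq mero_rel_refl_iff intro!: meromorphic_intros laurent_expansion_intros)
qed

lemma mero_expansion_qshift:
  assumes q: "q \<noteq> 0" and "mero_expansion (q * \<alpha>) g F"
  shows "mero_expansion \<alpha> (qshift q g) (fls_compose_fps F (fps_const q * fps_X))"
proof -
  obtain u where u: "u meromorphic_on (-{0})" "g = abs_mero u" "(\<lambda>w. u (q * \<alpha> + w)) has_laurent_expansion F"
    using assms unfolding mero_expansion_def by blast
  have "(\<lambda>x. u (q * x)) meromorphic_on (-{0})"
    by (rule meromorphic_on_compose[OF u(1)]) (use q in \<open>auto intro!: analytic_intros\<close>)
  moreover have "((\<lambda>w. u (q * \<alpha> + w)) \<circ> (\<lambda>w. q * w)) has_laurent_expansion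
      fls_compose_fps F (fps_const q * fps_X)"
  proof (rule has_laurent_expansion_compose[OF u(3)])
    show "(\<lambda>w. q * w) has_laurent_expansion fps_to_fls (fps_const q * fps_X)"
      by (intro has_laurent_expansion_fps fps_expansion_intros)
  qed (use q in auto)
  ultimately show ?thesis unfolding mero_expansion_def
    using u q by (intro exI[of _ "\<lambda>x. u (q * x)"])
       (auto simp: qshift.abs_eq mero_rel_refl_iff o_def distrib_left)
qed

text \<open>The identity theorem on the connected punctured plane: vanishing near one point, 0
  included, forces vanishing off a sparse set.\<close>

lemma mero_expansion_zero_imp_zero:
  assumes "mero_expansion \<alpha> g 0"
  shows "g = 0"
proof -
  obtain u where u: "u meromorphic_on (-{0})" "g = abs_mero u" "(\<lambda>w. u (\<alpha> + w)) has_laurent_expansion 0"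
    using assms unfolding mero_expansion_def by blast
  from u(3) have ev: "eventually (\<lambda>x. u x = 0) (at \<alpha>)"
    by (auto simp: has_laurent_expansion_def at_to_0[of \<alpha>] eventually_filtermap add.commute elim: eventually_mono)
  have "connected (-{0::complex})"
    by (intro connected_punctured_universe) auto
  hence "eventually (\<lambda>x. u x = 0) (cosparse (-{0})) \<or> eventually (\<lambda>x. u x \<noteq> 0) (cosparse (-{0}))"
    by (intro meromorphic_imp_constant_or_avoid u) auto
  moreover have "\<not> eventually (\<lambda>x. u x \<noteq> 0) (cosparse (-{0}))"
  proof
    assume "eventually (\<lambda>x. u x \<noteq> 0) (cosparse (-{0}))"
    hence *: "eventually (\<lambda>x. u x \<noteq> 0) (at x)" if "x \<noteq> 0" for x
      using that by (simp add: eventually_cosparse_punctured)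
    obtain S where S: "open S" "\<alpha> \<in> S" "\<And>x. x \<in> S - {\<alpha>} \<Longrightarrow> u x = 0"
      using ev unfolding eventually_at_topological by blast
    \<comment> \<open>\<open>\<alpha>\<close> may be 0, where the cosparse filter gives no
      information, so the contradiction is drawn at a nearby nonzero point.\<close>
    have "eventually (\<lambda>x. x \<in> S - {\<alpha>} \<and> x \<noteq> 0) (at \<alpha>)"
      using S eventually_neq_at_within[of 0 \<alpha> UNIV]
      by (intro eventually_conj eventually_at_in_open) auto
    then obtain x where x: "x \<in> S - {\<alpha>}" "x \<noteq> 0"
      using eventually_happens[of _ "at \<alpha>"] by fastforce
    have "eventually (\<lambda>y. y \<in> S - {\<alpha>}) (at x)"
      using x S by (intro eventually_at_in_open') auto
    with *[OF x(2)] have "eventually (\<lambda>y. False) (at x)"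
      by eventually_elim (use S(3) in blast)
    thus False by simp
  qed
  ultimately have "eventually (\<lambda>x. u x = 0) (cosparse (-{0}))" by blast
  hence "abs_mero u = abs_mero (\<lambda>_. 0)"
    using u by (subst abs_mero_eq_iff) auto
  thus ?thesis using u by (simp add: zero_mero.abs_eq)
qed

lemma mero_expansion_inject:
  assumes "mero_expansion \<alpha> g F" "mero_expansion \<alpha> h F"
  shows "g = h"
  using mero_expansion_zero_imp_zero[of \<alpha> "g - h"] mero_expansion_diff[OF assms] by simp

text \<open>The two expansions may come from different representatives. These agree near every
  nonzero point, so their difference cannot have a nonzero expansion.\<close>

lemma mero_expansion_unique:
  assumes "mero_expansion \<alpha> g F" "mero_expansion \<alpha> g G"
  shows "F = G"
proof -
  obtain u v where u: "u meromorphic_on (-{0})" "g = abs_mero u" "(\<lambda>w. u (\<alpha> + w)) has_laurent_expansion F"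
    and v: "v meromorphic_on (-{0})" "g = abs_mero v" "(\<lambda>w. v (\<alpha> + w)) has_laurent_expansion G"
    using assms unfolding mero_expansion_def by blast
  have eq: "eventually (\<lambda>y. u y = v y) (at x)" if "x \<noteq> 0" for x
    using abs_mero_eq_iff[OF u(1) v(1)] u(2) v(2) that by (simp add: eventually_cosparse_punctured)
  define d where "d x = u x - v x" for x
  have d: "(\<lambda>w. d (\<alpha> + w)) has_laurent_expansion F - G"
    unfolding d_def by (intro laurent_expansion_intros u v)
  have "F - G = 0"
  proof (rule ccontr)
    assume "F - G \<noteq> 0"
    hence "eventually (\<lambda>x. d x \<noteq> 0) (at \<alpha>)"
      using has_laurent_expansion_eventually_nonzero_iff[OF d] by simp
    then obtain S where S: "open S" "\<alpha> \<in> S" "\<And>x. x \<in> S - {\<alpha>} \<Longrightarrow> d x \<noteq> 0"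
      unfolding eventually_at_topological by blast
    have "eventually (\<lambda>x. x \<in> S - {\<alpha>} \<and> x \<noteq> 0) (at \<alpha>)"
      using S eventually_neq_at_within[of 0 \<alpha> UNIV]
      by (intro eventually_conj eventually_at_in_open) auto
    then obtain x where x: "x \<in> S - {\<alpha>}" "x \<noteq> 0"
      using eventually_happens[of _ "at \<alpha>"] by fastforce
    have "eventually (\<lambda>y. y \<in> S - {\<alpha>}) (at x)"
      using x S by (intro eventually_at_in_open') auto
    with eq[OF x(2)] have "eventually (\<lambda>y. False) (at x)"
      by eventually_elim (use S(3) in \<open>auto simp: d_def\<close>)
    thus False by simp
  qed
  thus ?thesis by simp
qed

lemma mero_expansion_exists:
  assumes "\<alpha> \<noteq> 0"
  obtains F where "mero_expansion \<alpha> g F"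
proof -
  obtain u where "u meromorphic_on (-{0})" "g = abs_mero u" by (rule mero_cases)
  thus thesis
    using that meromorphic_on_imp_has_laurent_expansion[of u "-{0}" \<alpha>] assms
    unfolding mero_expansion_def by blast
qed

lemma mero_expansion_abs_mero:
  assumes "z meromorphic_on UNIV"
  obtains F where "mero_expansion \<alpha> (abs_mero z) F"
  using that meromorphic_on_imp_has_laurent_expansion[OF assms, of \<alpha>] meromorphic_on_subset[OF assms, of "-{0}"]
  unfolding mero_expansion_def by blast

text \<open>Identities between meromorphic functions are checked on the expansions at the point 1.\<close>

lemma mero_const_add: "mero_const (c + d) = mero_const c + mero_const d"
  and mero_const_mult: "mero_const (c * d) = mero_const c * mero_const d"
  and mero_const_0: "mero_const 0 = 0"
  and mero_const_1: "mero_const 1 = 1"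
proof -
  note e = mero_expansion_const[of 1] mero_expansion_0[of 1] mero_expansion_1[of 1]
  show "mero_const (c + d) = mero_const c + mero_const d"
    using e(1)[of "c + d"] mero_expansion_add[OF e(1)[of c] e(1)[of d]]
    by (intro mero_expansion_inject) (auto simp: fls_plus_const)
  show "mero_const (c * d) = mero_const c * mero_const d"
    using e(1)[of "c * d"] mero_expansion_mult[OF e(1)[of c] e(1)[of d]]
    by (intro mero_expansion_inject) auto
  show "mero_const 0 = 0"
    using e(1)[of 0] e(2) by (intro mero_expansion_inject) auto
  show "mero_const 1 = 1"
    using e(1)[of 1] e(3) by (intro mero_expansion_inject) auto
qed

lemma mero_const_uminus: "mero_const (- c) = - mero_const c"
  using mero_const_add[of c "- c"] by (simp add: mero_const_0 add_eq_0_iff)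

lemma mero_const_diff: "mero_const (c - d) = mero_const c - mero_const d"
  using mero_const_add[of c "- d"] by (simp add: mero_const_uminus)

lemma mero_const_inverse: "mero_const (inverse c) = inverse (mero_const c)"
proof (cases "c = 0")
  case False
  hence "mero_const c * mero_const (inverse c) = 1"
    by (simp add: mero_const_1 flip: mero_const_mult)
  thus ?thesis by (metis inverse_unique)
qed (simp add: mero_const_0)

lemma mero_const_eq_iff: "mero_const c = mero_const d \<longleftrightarrow> c = d"
proof
  assume "mero_const c = mero_const d"
  hence "fls_const c = fls_const d"
    using mero_expansion_unique[of 1 "mero_const c"] mero_expansion_const by metis
  from arg_cong[OF this, of "\<lambda>F. fls_nth F 0"] show "c = d" by simp
qed simp

lemma mero_const_eq_0_iff: "mero_const c = 0 \<longleftrightarrow> c = 0"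
  using mero_const_eq_iff[of c 0] by (simp add: mero_const_0)

lemma mero_of_nat: "of_nat n = mero_const (of_nat n)"
  by (induction n) (auto simp: mero_const_0 mero_const_1 mero_const_add)

instance mero :: field_char_0
  by standard (auto simp: inj_def mero_of_nat mero_const_eq_iff)

lemma mero_of_int: "of_int n = mero_const (of_int n)"
  by (cases n) (simp_all add: mero_of_nat mero_const_uminus mero_const_1 mero_const_add del: of_nat_Suc)

lemma mero_X_nz: "mero_X \<noteq> 0"
proof
  assume "mero_X = 0"
  hence "fls_const 1 + fls_X = (0 :: complex fls)"
    using mero_expansion_unique mero_expansion_X mero_expansion_0 by metis
  from arg_cong[OF this, of "\<lambda>F. fls_nth F 0"] show False by simp
qed

lemma fls_deriv_compose_linear:
  fixes F :: "'a::field fls"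
  assumes "q \<noteq> 0"
  shows "fls_deriv (fls_compose_fps F (fps_const q * fps_X))
    = fls_const q * fls_compose_fps (fls_deriv F) (fps_const q * fps_X)"
proof (rule fls_eqI)
  fix n
  have "q powi (n + 1) = q powi n * q" using assms by (simp add: power_int_add)
  thus "fls_nth (fls_deriv (fls_compose_fps F (fps_const q * fps_X))) n
      = fls_nth (fls_const q * fls_compose_fps (fls_deriv F) (fps_const q * fps_X)) n"
    unfolding fls_deriv_nth fls_mult_const_nth fls_nth_fls_compose_fps_linear[OF assms] by simp
qed

section \<open>Rules for the q-shift and the Euler derivative\<close>

context
  fixes q :: complex
  assumes q: "q \<noteq> 0"
begin

lemma qshift_add: "qshift q (g + h) = qshift q g + qshift q h"
  and qshift_mult: "qshift q (g * h) = qshift q g * qshift q h"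
proof -
  obtain F G where FG: "mero_expansion (q * 1) g F" "mero_expansion (q * 1) h G"
    using mero_expansion_exists q by (metis mult_cancel_left2 no_zero_divisors zero_neq_one)
  note e = mero_expansion_qshift[OF q]
  show "qshift q (g + h) = qshift q g + qshift q h"
    using e[OF mero_expansion_add[OF FG]] mero_expansion_add[OF e[OF FG(1)] e[OF FG(2)]] q
    by (intro mero_expansion_inject) (auto simp: fls_compose_fps_add)
  show "qshift q (g * h) = qshift q g * qshift q h"
    using e[OF mero_expansion_mult[OF FG]] mero_expansion_mult[OF e[OF FG(1)] e[OF FG(2)]] q
    by (intro mero_expansion_inject) (auto simp: fls_compose_fps_mult)
qed

lemma qshift_const: "qshift q (mero_const c) = mero_const c"
  using mero_expansion_qshift[OF q mero_expansion_const[of "q * 1"]] mero_expansion_const[of 1]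
  by (intro mero_expansion_inject) auto

lemma qshift_X: "qshift q mero_X = mero_const q * mero_X"
proof (rule mero_expansion_inject)
  show "mero_expansion 1 (mero_const q * mero_X) (fls_const q * (fls_const 1 + fls_X))"
    by (intro mero_expansion_mult mero_expansion_const mero_expansion_X)
  show "mero_expansion 1 (qshift q mero_X) (fls_const q * (fls_const 1 + fls_X))"
    using mero_expansion_qshift[OF q mero_expansion_X[of "q * 1"]] q
    by (simp add: fls_compose_fps_add distrib_left fls_times_fps_to_fls)
qed

text \<open>The factor \<open>q\<close> of the chain rule matches the one that the shift produces
  from the coordinate factor of the Euler derivative.\<close>

lemma qshift_euler_deriv: "euler_deriv (qshift q g) = qshift q (euler_deriv g)"
proof -
  obtain F where F: "mero_expansion (q * 1) g F"
    using mero_expansion_exists q by (metis mult_cancel_left2 no_zero_divisors zero_neq_one)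
  let ?H = "fps_const q * fps_X"
  have "fls_compose_fps ((fls_const (q * 1) + fls_X) * fls_deriv F) ?H
      = (fls_const 1 + fls_X) * fls_deriv (fls_compose_fps F ?H)"
    unfolding fls_deriv_compose_linear[OF q] using q
    by (simp add: fls_compose_fps_mult fls_compose_fps_add fls_times_fps_to_fls distrib_left distrib_right
        mult.assoc mult.left_commute)
  thus ?thesis
    using mero_expansion_qshift[OF q mero_expansion_euler_deriv[OF F]]
      mero_expansion_euler_deriv[OF mero_expansion_qshift[OF q F]]
    by (metis mero_expansion_inject)
qed

end

lemma euler_deriv_add: "euler_deriv (g + h) = euler_deriv g + euler_deriv h"
  and euler_deriv_mult: "euler_deriv (g * h) = g * euler_deriv h + euler_deriv g * h"
proof -
  obtain F G where FG: "mero_expansion 1 g F" "mero_expansion 1 h G"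
    using mero_expansion_exists by (metis zero_neq_one)
  note e = mero_expansion_euler_deriv
  show "euler_deriv (g + h) = euler_deriv g + euler_deriv h"
    using e[OF mero_expansion_add[OF FG]] mero_expansion_add[OF e[OF FG(1)] e[OF FG(2)]]
    by (intro mero_expansion_inject) (auto simp: algebra_simps)
  show "euler_deriv (g * h) = g * euler_deriv h + euler_deriv g * h"
    using e[OF mero_expansion_mult[OF FG]]
      mero_expansion_add[OF mero_expansion_mult[OF FG(1) e[OF FG(2)]] mero_expansion_mult[OF e[OF FG(1)] FG(2)]]
    by (intro mero_expansion_inject) (auto simp: algebra_simps)
qed

lemma euler_deriv_const: "euler_deriv (mero_const c) = 0"
  using mero_expansion_euler_deriv[OF mero_expansion_const[of 1 c]] mero_expansion_0[of 1]
  by (intro mero_expansion_inject) auto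

lemma euler_deriv_X: "euler_deriv mero_X = mero_X"
  using mero_expansion_euler_deriv[OF mero_expansion_X[of 1]] mero_expansion_X[of 1]
  by (intro mero_expansion_inject) auto

section \<open>Poles and rational functions\<close>

text \<open>As \<open>fls_subdegree 0 = 0\<close>, the zero function counts as regular. At 0 the
  condition includes the existence of an expansion.\<close>

definition regular_at :: "complex \<Rightarrow> mero \<Rightarrow> bool" where
  "regular_at \<alpha> g \<longleftrightarrow> (\<exists>F. mero_expansion \<alpha> g F \<and> fls_subdegree F \<ge> 0)"

lemma regular_at_iff: "mero_expansion \<alpha> g F \<Longrightarrow> regular_at \<alpha> g \<longleftrightarrow> fls_subdegree F \<ge> 0"
  unfolding regular_at_def using mero_expansion_unique by blast

lemma regular_at_const: "regular_at \<alpha> (mero_const c)"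
  using mero_expansion_const by (force simp: regular_at_def)

lemma regular_at_add:
  assumes "regular_at \<alpha> g" "regular_at \<alpha> h"
  shows "regular_at \<alpha> (g + h)"
proof -
  obtain F G where FG: "mero_expansion \<alpha> g F" "fls_subdegree F \<ge> 0" "mero_expansion \<alpha> h G" "fls_subdegree G \<ge> 0"
    using assms by (auto simp: regular_at_def)
  have "fls_subdegree (F + G) \<ge> 0"
    by (rule fls_subdegree_ge0I) (use FG in auto)
  thus ?thesis using mero_expansion_add[OF FG(1,3)] by (auto simp: regular_at_def)
qed

lemma regular_at_mult:
  assumes "regular_at \<alpha> g" "regular_at \<alpha> h"
  shows "regular_at \<alpha> (g * h)"
proof -
  obtain F G where FG: "mero_expansion \<alpha> g F" "fls_subdegree F \<ge> 0" "mero_expansion \<alpha> h G" "fls_subdegree G \<ge> 0"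
    using assms by (auto simp: regular_at_def)
  have "fls_subdegree (F * G) \<ge> 0"
    using FG by (cases "F = 0 \<or> G = 0") auto
  thus ?thesis using mero_expansion_mult[OF FG(1,3)] by (auto simp: regular_at_def)
qed

lemma regular_at_uminus: "regular_at \<alpha> g \<Longrightarrow> regular_at \<alpha> (- g)"
  using regular_at_mult[OF regular_at_const[of \<alpha> "-1"]] by (simp add: mero_const_minus_1)

lemma regular_at_diff: "regular_at \<alpha> g \<Longrightarrow> regular_at \<alpha> h \<Longrightarrow> regular_at \<alpha> (g - h)"
  using regular_at_add[of \<alpha> g "- h"] regular_at_uminus[of \<alpha> h] by simp

lemma regular_at_sum: "(\<And>i. i \<in> I \<Longrightarrow> regular_at \<alpha> (g i)) \<Longrightarrow> regular_at \<alpha> (sum g I)"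
  using regular_at_const[of \<alpha> 0]
  by (induction I rule: infinite_finite_induct) (auto simp: mero_const_0 intro: regular_at_add)

text \<open>Substituting \<open>q * X\<close> for \<open>X\<close> does not change the order of a
  Laurent series.\<close>

lemma regular_at_qshift_iff:
  assumes q: "q \<noteq> 0" and "\<alpha> \<noteq> 0"
  shows "regular_at \<alpha> (qshift q g) \<longleftrightarrow> regular_at (q * \<alpha>) g"
proof -
  obtain F where F: "mero_expansion (q * \<alpha>) g F"
    using mero_expansion_exists assms by (metis mult_eq_0_iff)
  let ?G = "fls_compose_fps F (fps_const q * fps_X)"
  have "subdegree (fps_const q * fps_X) = 1"
    using q by simp
  hence "fls_subdegree ?G = fls_subdegree F"
    using subdegree_fls_compose_fps[of "fps_const q * fps_X" F] by simp
  thus ?thesis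
    using regular_at_iff[OF F] regular_at_iff[OF mero_expansion_qshift[OF q F]]
    by (simp del: subdegree_fls_compose_fps)
qed

section \<open>Polynomials and rational functions of the coordinate\<close>

definition mero_poly :: "complex poly \<Rightarrow> mero" where
  "mero_poly p = poly (map_poly mero_const p) mero_X"

lemma mero_poly_0: "mero_poly 0 = 0"
  by (simp add: mero_poly_def)

lemma mero_poly_pCons: "mero_poly (pCons c p) = mero_const c + mero_X * mero_poly p"
  by (simp add: mero_poly_def map_poly_pCons mero_const_0)

lemma mero_poly_add: "mero_poly (p + r) = mero_poly p + mero_poly r"
  by (induction p r rule: poly_induct2) (simp_all add: mero_poly_pCons mero_poly_0 mero_const_add algebra_simps)

lemma mero_poly_smult: "mero_poly (smult c p) = mero_const c * mero_poly p"
  by (induction p) (simp_all add: mero_poly_pCons mero_poly_0 mero_const_mult algebra_simps)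

lemma mero_poly_mult: "mero_poly (p * r) = mero_poly p * mero_poly r"
  by (induction p)
     (simp_all add: mero_poly_pCons mero_poly_0 mero_poly_add mero_poly_smult mero_const_0 algebra_simps)

lemma mero_poly_monom: "mero_poly (monom c n) = mero_const c * mero_X ^ n"
  by (simp add: mero_poly_def map_poly_monom mero_const_0 poly_monom)

lemma mero_expansion_poly:
  "\<exists>F. mero_expansion \<alpha> (mero_poly p) F \<and> fls_subdegree F \<ge> 0 \<and> fls_nth F 0 = poly p \<alpha> \<and>
     (\<alpha> = 0 \<longrightarrow> (\<forall>n > int (degree p). fls_nth F n = 0))"
proof (induction p)
  case 0
  show ?case by (intro exI[of _ 0]) (auto simp: mero_poly_0 mero_expansion_0)
next
  case (pCons c p)
  then obtain F where F: "mero_expansion \<alpha> (mero_poly p) F" "fls_subdegree F \<ge> 0" "fls_nth F 0 = poly p \<alpha>"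
    "\<alpha> = 0 \<Longrightarrow> \<forall>n > int (degree p). fls_nth F n = 0" by auto
  let ?G = "fls_const c + (fls_const \<alpha> + fls_X) * F"
  have nth: "fls_nth ?G n = (if n = 0 then c else 0) + \<alpha> * fls_nth F n + fls_nth F (n - 1)" for n
    by (simp add: distrib_right fls_X_times_conv_shift)
  have "mero_expansion \<alpha> (mero_poly (pCons c p)) ?G"
    unfolding mero_poly_pCons
    by (intro mero_expansion_add mero_expansion_mult mero_expansion_const mero_expansion_X F)
  moreover have "fls_subdegree ?G \<ge> 0"
    by (rule fls_subdegree_ge0I) (unfold nth, use F(2) in auto)
  moreover have "fls_nth ?G 0 = poly (pCons c p) \<alpha>"
    unfolding nth using F(2,3) by simp
  moreover have "fls_nth ?G n = 0" if "\<alpha> = 0" "n > int (degree (pCons c p))" for n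
  proof -
    \<comment> \<open>For \<open>p = 0\<close> the degree does not rise from \<open>p\<close> to
      \<open>pCons c p\<close>, so the case \<open>n = 1\<close> needs the vanishing constant term
      of \<open>F\<close>.\<close>
    have "n - 1 > int (degree p) \<or> (p = 0 \<and> n > 0)"
      using that by (auto simp: degree_pCons_eq_if split: if_splits)
    moreover have "fls_nth F n = 0" if "p = 0" "n > 0" for n
      using F(4)[OF \<open>\<alpha> = 0\<close>] that by simp
    moreover have "fls_nth F 0 = 0" if "p = 0" using F(3) that by simp
    ultimately have "fls_nth F (n - 1) = 0"
      using F(4)[OF that(1)] by (cases "n = 1") auto
    thus ?thesis unfolding nth using that by auto
  qed
  ultimately show ?case by blast
qed

lemma mero_poly_eq_0_iff: "mero_poly p = 0 \<longleftrightarrow> p = 0"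
proof
  assume *: "mero_poly p = 0"
  have "poly p \<alpha> = 0" for \<alpha>
    using mero_expansion_poly[of \<alpha> p] mero_expansion_unique[OF mero_expansion_0[of \<alpha>]] *
    by (metis fls_zero_nth)
  thus "p = 0" using poly_all_0_iff_0 by blast
qed (simp add: mero_poly_0)

lemma regular_at_poly: "regular_at \<alpha> (mero_poly p)"
  using mero_expansion_poly[of \<alpha> p] by (auto simp: regular_at_def)

lemma regular_at_poly_ratio:
  assumes "poly r \<alpha> \<noteq> 0"
  shows "regular_at \<alpha> (mero_poly p / mero_poly r)"
proof -
  obtain G where G: "mero_expansion \<alpha> (mero_poly r) G" "fls_subdegree G \<ge> 0" "fls_nth G 0 = poly r \<alpha>"
    using mero_expansion_poly[of \<alpha> r] by blast
  have "fls_subdegree G \<le> 0"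
    by (rule fls_subdegree_leI) (use G assms in simp)
  hence "fls_subdegree (inverse G) = 0" using G(2) by simp
  hence "regular_at \<alpha> (inverse (mero_poly r))"
    using mero_expansion_inverse[OF G(1)] by (auto simp: regular_at_def)
  thus ?thesis unfolding divide_inverse by (intro regular_at_mult regular_at_poly)
qed

text \<open>Constant terms are compared in the product of \<open>g\<close> with its denominator; for
  regular factors the constant term is multiplicative.\<close>

lemma expansion_poly_ratio:
  assumes g: "g = mero_poly p / mero_poly r" and F: "mero_expansion \<alpha> g F" and r: "r \<noteq> 0"
    and "regular_at \<alpha> g"
  shows "fls_nth F 0 * poly r \<alpha> = poly p \<alpha>"
proof -
  obtain P where P: "mero_expansion \<alpha> (mero_poly p) P" "fls_nth P 0 = poly p \<alpha>"
    using mero_expansion_poly[of \<alpha> p] by blast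
  obtain R where R: "mero_expansion \<alpha> (mero_poly r) R" "fls_nth R 0 = poly r \<alpha>" "fls_subdegree R \<ge> 0"
    using mero_expansion_poly[of \<alpha> r] by blast
  have "mero_poly p = g * mero_poly r" using g r by (simp add: mero_poly_eq_0_iff)
  hence "P = F * R"
    using mero_expansion_unique[OF P(1)] mero_expansion_mult[OF F R(1)] by simp
  moreover have F0: "fls_subdegree F \<ge> 0" using assms regular_at_iff[OF F] by simp
  have "fls_nth (F * R) 0 = fls_nth F 0 * fls_nth R 0"
  proof -
    have "F = fps_to_fls (fls_regpart F)" "R = fps_to_fls (fls_regpart R)"
      using F0 R(3) by (simp_all add: fls_regpart_to_fls_trivial)
    hence "F * R = fps_to_fls (fls_regpart F * fls_regpart R)"
      by (metis fls_times_fps_to_fls)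
    thus ?thesis by simp
  qed
  ultimately show ?thesis using P R by simp
qed

lemma is_subfield_consts: "is_subfield (range mero_const)"
  unfolding is_subfield_def
  by (metis (no_types, lifting) imageE mero_const_1 mero_const_diff mero_const_inverse mero_const_mult rangeI)

lemma is_subfield_rat_funs: "is_subfield rat_funs"
  unfolding rat_funs_def by (rule is_subfield_field_adjoin[OF is_subfield_consts])

lemma const_rat_funs: "mero_const c \<in> rat_funs"
  unfolding rat_funs_def using field_adjoin_base[OF is_subfield_consts] by blast

lemma X_rat_funs: "mero_X \<in> rat_funs"
  unfolding rat_funs_def by (rule field_adjoin_gen[OF is_subfield_consts])

lemma coeffs_in_consts: "coeffs_in (range mero_const) P \<Longrightarrow> \<exists>p. P = map_poly mero_const p"
proof -
  assume P: "coeffs_in (range mero_const) P"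
  have "map_poly mero_const (map_poly (inv mero_const) P) = P"
  proof (rule poly_eqI)
    fix i
    have "inv mero_const 0 = 0"
      using mero_const_0 mero_const_eq_iff by (metis injI inv_f_f)
    thus "coeff (map_poly mero_const (map_poly (inv mero_const) P)) i = coeff P i"
      using P by (simp add: coeff_map_poly mero_const_0 coeffs_in_def f_inv_into_f)
  qed
  thus ?thesis by metis
qed

text \<open>A representation with denominator of least degree is in lowest terms, since a common
  root would give a linear factor to cancel.\<close>

lemma rat_funsE:
  assumes "g \<in> rat_funs"
  obtains p r where "r \<noteq> 0" "g = mero_poly p / mero_poly r" "\<And>\<alpha>. poly p \<alpha> = 0 \<Longrightarrow> poly r \<alpha> \<noteq> 0"
proof -
  define A where "A n \<longleftrightarrow> (\<exists>p r. r \<noteq> 0 \<and> g = mero_poly p / mero_poly r \<and> degree r = n)" for n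
  obtain P R where "coeffs_in (range mero_const) P" "coeffs_in (range mero_const) R" "poly R mero_X \<noteq> 0"
    "g = poly P mero_X / poly R mero_X"
    using assms unfolding rat_funs_def by (rule field_adjoinE[OF is_subfield_consts])
  then obtain p r where "poly (map_poly mero_const r) mero_X \<noteq> 0"
    "g = poly (map_poly mero_const p) mero_X / poly (map_poly mero_const r) mero_X"
    using coeffs_in_consts by metis
  hence "A (degree r)"
    unfolding A_def by (intro exI[of _ p] exI[of _ r]) (auto simp: mero_poly_def)
  then obtain n where n: "A n" "\<And>i. i < n \<Longrightarrow> \<not> A i"
    using exists_least_iff[of A] by blast
  then obtain p r where pr: "r \<noteq> 0" "g = mero_poly p / mero_poly r" "degree r = n"
    by (auto simp: A_def)
  have "poly r \<alpha> \<noteq> 0" if "poly p \<alpha> = 0" for \<alpha>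
  proof
    assume "poly r \<alpha> = 0"
    with that obtain p' r' where eq: "p = [:-\<alpha>, 1:] * p'" "r = [:-\<alpha>, 1:] * r'"
      by (auto simp: poly_eq_0_iff_dvd elim!: dvdE)
    have "r' \<noteq> 0" using pr eq by auto
    moreover have "degree r' < n"
      using pr(3) \<open>r' \<noteq> 0\<close> unfolding eq by (simp add: degree_mult_eq del: mult_pCons_left)
    moreover have "mero_poly [:-\<alpha>, 1:] \<noteq> 0" by (simp add: mero_poly_eq_0_iff)
    hence "g = mero_poly p' / mero_poly r'"
      unfolding pr(2) eq mero_poly_mult by simp
    ultimately show False using n(2)[of "degree r'"] by (auto simp: A_def)
  qed
  thus thesis using that pr by blast
qed

lemma finite_poles_rat_funs:
  assumes "g \<in> rat_funs"
  shows "finite {\<alpha>. \<alpha> \<noteq> 0 \<and> \<not> regular_at \<alpha> g}"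
proof -
  obtain p r where r: "r \<noteq> 0" "g = mero_poly p / mero_poly r"
    by (rule rat_funsE[OF assms])
  have "poly r \<alpha> = 0" if "\<not> regular_at \<alpha> g" for \<alpha>
    using that regular_at_poly_ratio[of r \<alpha> p] r(2) by blast
  thus ?thesis
    by (intro finite_subset[OF _ poly_roots_finite[OF r(1)]]) auto
qed

text \<open>After the root 0 is split off, the cofactor has no root and is constant by the
  fundamental theorem of algebra.\<close>

lemma poly_only_root_0:
  fixes p :: "complex poly"
  assumes "p \<noteq> 0" "\<And>\<alpha>. poly p \<alpha> = 0 \<Longrightarrow> \<alpha> = 0"
  obtains c n where "c \<noteq> 0" "p = monom c n"
proof -
  obtain s where s: "p = [:-0, 1:] ^ order 0 p * s" "\<not> [:-0, 1:] dvd s"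
    using order_decomp[OF assms(1), of 0] by blast
  have "poly s \<alpha> \<noteq> 0" for \<alpha>
  proof
    assume *: "poly s \<alpha> = 0"
    hence "poly p \<alpha> = 0" by (subst s(1)) simp
    hence "\<alpha> = 0" by (rule assms(2))
    with * s(2) show False using poly_eq_0_iff_dvd[of s 0] by simp
  qed
  hence "constant (poly s)" using Fundamental_Theorem_Algebra.fundamental_theorem_of_algebra by blast
  then obtain c where "s = [:c:]"
    using constant_degree[of s] by (auto elim: degree_eq_zeroE)
  moreover have "[:-0, 1:] = (monom 1 1 :: complex poly)" by (simp add: monom_altdef)
  ultimately have "p = monom c (order 0 p)"
    using s(1) by (simp add: monom_altdef mult.commute)
  thus thesis using that assms(1) by (metis monom_eq_0_iff)
qed

text \<open>In lowest terms a root of the denominator is a pole, so the denominator is a monomial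
  and the function a Laurent polynomial.\<close>

lemma regular_rat_fun_expansion_finite:
  assumes g: "g \<in> rat_funs" and reg: "\<And>\<alpha>. \<alpha> \<noteq> 0 \<Longrightarrow> regular_at \<alpha> g"
  shows "\<exists>F N. mero_expansion 0 g F \<and> (\<forall>n>N. fls_nth F n = 0)"
proof -
  obtain p r where pr: "r \<noteq> 0" "g = mero_poly p / mero_poly r" "\<And>\<alpha>. poly p \<alpha> = 0 \<Longrightarrow> poly r \<alpha> \<noteq> 0"
    by (rule rat_funsE[OF g]) blast
  have "\<alpha> = 0" if "poly r \<alpha> = 0" for \<alpha>
  proof (rule ccontr)
    assume \<alpha>: "\<alpha> \<noteq> 0"
    obtain F where F: "mero_expansion \<alpha> g F" by (rule mero_expansion_exists[OF \<alpha>])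
    have "poly p \<alpha> = 0"
      using expansion_poly_ratio[OF pr(2) F pr(1) reg[OF \<alpha>]] that by simp
    thus False using pr(3) that by blast
  qed
  then obtain c m where c: "c \<noteq> 0" "r = monom c m"
    using poly_only_root_0[OF pr(1)] by blast
  obtain P where P: "mero_expansion 0 (mero_poly p) P" "\<forall>n > int (degree p). fls_nth P n = 0"
    using mero_expansion_poly[of 0 p] by blast
  have g_eq: "g = mero_const (inverse c) * mero_poly p * mero_X powi (- int m)"
    unfolding pr(2) c mero_poly_monom
    by (simp add: mero_const_inverse power_int_minus divide_inverse mult_ac del: inverse_eq_divide)
  have X: "mero_expansion 0 mero_X fls_X"
    using mero_expansion_X[of 0] by simp
  define G where "G = fls_const (inverse c) * P * fls_X powi (- int m)"
  have "mero_expansion 0 g G"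
    unfolding g_eq G_def
    by (intro mero_expansion_mult mero_expansion_const mero_expansion_power_int P X)
  moreover have "fls_nth G n = 0" if "n > int (degree p)" for n
  proof -
    have "fls_nth G n = inverse c * fls_nth P (n + int m)"
      by (simp add: G_def fls_shifted_times_simps)
    thus ?thesis using P(2) that by simp
  qed
  ultimately show ?thesis by blast
qed

lemma fls_eq_finite_sum:
  fixes F :: "'a::division_ring fls"
  assumes "\<And>n. n < M \<Longrightarrow> fls_nth F n = 0" "\<And>n. n > N \<Longrightarrow> fls_nth F n = 0"
  shows "F = (\<Sum>n\<in>{M..N}. fls_const (fls_nth F n) * fls_X powi n)"
proof (rule fls_eqI)
  fix k
  have "fls_nth (\<Sum>n\<in>{M..N}. fls_const (fls_nth F n) * fls_X powi n) k
      = (\<Sum>n\<in>{M..N}. if k = n then fls_nth F n else 0)"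
    unfolding fls_nth_sum by (rule sum.cong) (auto simp: fls_X_power_int)
  also have "\<dots> = fls_nth F k"
    using assms[of k] by (auto simp: not_le)
  finally show "fls_nth F k = fls_nth (\<Sum>n\<in>{M..N}. fls_const (fls_nth F n) * fls_X powi n) k" ..
qed

text \<open>An expansion at 0 that stops is that of a Laurent polynomial, and equal expansions mean
  equal functions.\<close>

lemma finite_expansion_rat_funs:
  assumes F: "mero_expansion 0 g F" and N: "\<And>n. n > N \<Longrightarrow> fls_nth F n = 0"
  shows "g \<in> rat_funs"
proof -
  let ?I = "{fls_subdegree F..N}"
  have X: "mero_expansion 0 mero_X fls_X"
    using mero_expansion_X[of 0] by simp
  have "mero_expansion 0 (\<Sum>n\<in>?I. mero_const (fls_nth F n) * mero_X powi n)
      (\<Sum>n\<in>?I. fls_const (fls_nth F n) * fls_X powi n)"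
    by (intro mero_expansion_sum mero_expansion_mult mero_expansion_const mero_expansion_power_int X)
  also have "(\<Sum>n\<in>?I. fls_const (fls_nth F n) * fls_X powi n) = F"
    by (rule fls_eq_finite_sum[symmetric]) (use N in auto)
  finally have "g = (\<Sum>n\<in>?I. mero_const (fls_nth F n) * mero_X powi n)"
    using F by (rule mero_expansion_inject[rotated])
  also have "\<dots> \<in> rat_funs"
    using is_subfield_rat_funs
    by (intro subfield_sum subfield_mult subfield_power_int const_rat_funs X_rat_funs)
  finally show ?thesis .
qed

text \<open>\<open>f\<close> is the principal part at \<open>\<alpha>\<close>, whose only finite
  pole is \<open>\<alpha>\<close>.\<close>

lemma remove_pole:
  assumes "\<alpha> \<noteq> 0"
  shows "\<exists>f\<in>rat_funs. regular_at \<alpha> (y - f) \<and> (\<forall>\<beta>. \<beta> \<noteq> \<alpha> \<longrightarrow> regular_at \<beta> f)"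
proof -
  obtain F where F: "mero_expansion \<alpha> y F" by (rule mero_expansion_exists[OF assms])
  define f where "f = (\<Sum>n\<in>{fls_subdegree F..-1}. mero_const (fls_nth F n) * (mero_X - mero_const \<alpha>) powi n)"
  have "f \<in> rat_funs"
    unfolding f_def using is_subfield_rat_funs
    by (intro subfield_sum subfield_mult subfield_power_int subfield_diff const_rat_funs X_rat_funs)
  moreover have "regular_at \<alpha> (y - f)"
  proof -
    let ?P = "\<Sum>n\<in>{fls_subdegree F..-1}. fls_const (fls_nth F n) * fls_X powi n"
    have "mero_expansion \<alpha> (mero_X - mero_const \<alpha>) fls_X"
      using mero_expansion_diff[OF mero_expansion_X[of \<alpha>] mero_expansion_const[of \<alpha> \<alpha>]] by simp
    hence e: "mero_expansion \<alpha> (y - f) (F - ?P)"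
      unfolding f_def
      by (intro mero_expansion_diff mero_expansion_sum mero_expansion_mult mero_expansion_const
          mero_expansion_power_int F)
    have "fls_nth ?P k = fls_nth F k" if "k < 0" for k
    proof -
      have "fls_nth ?P k = (\<Sum>n\<in>{fls_subdegree F..-1}. if k = n then fls_nth F n else 0)"
        unfolding fls_nth_sum by (rule sum.cong) (auto simp: fls_X_power_int)
      thus ?thesis using that by (auto simp: not_le)
    qed
    hence "fls_subdegree (F - ?P) \<ge> 0"
      by (intro fls_subdegree_ge0I) simp
    thus ?thesis using e by (auto simp: regular_at_def)
  qed
  moreover have "regular_at \<beta> f" if "\<beta> \<noteq> \<alpha>" for \<beta>
  proof -
    let ?G = "fls_const (\<beta> - \<alpha>) + fls_X"
    have e: "mero_expansion \<beta> (mero_X - mero_const \<alpha>) ?G"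
      using mero_expansion_diff[OF mero_expansion_X[of \<beta>] mero_expansion_const[of \<beta> \<alpha>]]
      by (simp add: fls_minus_const[symmetric] algebra_simps)
    have "fls_subdegree ?G = 0"
      by (rule fls_subdegree_eqI) (use that in auto)
    hence "regular_at \<beta> ((mero_X - mero_const \<alpha>) powi n)" for n
      using mero_expansion_power_int[OF e, of n] unfolding regular_at_def
      by (intro exI[of _ "?G powi n"]) simp
    thus ?thesis
      unfolding f_def by (intro regular_at_sum regular_at_mult regular_at_const)
  qed
  ultimately show ?thesis by blast
qed

lemma remove_poles:
  assumes "finite A" "\<And>\<alpha>. \<alpha> \<noteq> 0 \<Longrightarrow> \<not> regular_at \<alpha> y \<Longrightarrow> \<alpha> \<in> A" "0 \<notin> A"
  shows "\<exists>f\<in>rat_funs. \<forall>\<alpha>. \<alpha> \<noteq> 0 \<longrightarrow> regular_at \<alpha> (y - f)"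
  using assms
proof (induction A arbitrary: y rule: finite_induct)
  case empty
  thus ?case using subfield_0[OF is_subfield_rat_funs] by (intro bexI[of _ 0]) auto
next
  case (insert \<beta> A)
  obtain f where f: "f \<in> rat_funs" "regular_at \<beta> (y - f)" "\<And>\<gamma>. \<gamma> \<noteq> \<beta> \<Longrightarrow> regular_at \<gamma> f"
    using remove_pole[of \<beta> y] insert.prems by auto
  have "\<alpha> \<in> A" if "\<alpha> \<noteq> 0" "\<not> regular_at \<alpha> (y - f)" for \<alpha>
  proof -
    have "\<alpha> \<noteq> \<beta>" using f that by auto
    moreover have "\<not> regular_at \<alpha> y"
      using that f(3)[OF \<open>\<alpha> \<noteq> \<beta>\<close>] regular_at_diff by blast
    ultimately show ?thesis using insert.prems(1)[OF that(1)] by blast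
  qed
  then obtain f' where f': "f' \<in> rat_funs" "\<And>\<alpha>. \<alpha> \<noteq> 0 \<Longrightarrow> regular_at \<alpha> (y - f - f')"
    using insert.IH[of "y - f"] insert.prems by auto
  show ?case
    using f' f(1) subfield_add[OF is_subfield_rat_funs]
    by (intro bexI[of _ "f + f'"]) (auto simp: algebra_simps)
qed

text \<open>At a pole off 0 the Euler derivative raises the pole order by exactly one, so the
  highest derivative with nonzero coefficient cannot be cancelled. Hence the poles of
  \<open>y\<close> off 0 are found among those of the combination.\<close>

lemma deriv_combination_pole:
  assumes \<alpha>: "\<alpha> \<noteq> 0" and y: "\<not> regular_at \<alpha> y" and c: "\<exists>i<m. c i \<noteq> 0"
  shows "\<not> regular_at \<alpha> (\<Sum>i<m. mero_const (c i) * (euler_deriv ^^ i) y)"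
proof -
  obtain F where F: "mero_expansion \<alpha> y F" by (rule mero_expansion_exists[OF \<alpha>])
  define E :: "complex fls \<Rightarrow> complex fls" where "E = (\<lambda>F. (fls_const \<alpha> + fls_X) * fls_deriv F)"
  define s where "s = fls_subdegree F"
  have s: "s < 0" using y regular_at_iff[OF F] by (simp add: s_def)
  have sub0: "fls_subdegree (fls_const \<alpha> + fls_X) = 0"
    by (rule fls_subdegree_eqI) (use \<alpha> in auto)
  hence nz: "fls_const \<alpha> + fls_X \<noteq> 0"
    using \<alpha> by (auto simp: fls_eq_iff dest: spec[of _ 0])
  have e: "mero_expansion \<alpha> ((euler_deriv ^^ i) y) ((E ^^ i) F)" for i
    by (induction i) (auto simp: F E_def intro: mero_expansion_euler_deriv)
  have sub: "fls_subdegree ((E ^^ i) F) = s - int i" for i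
  proof (induction i)
    case (Suc i)
    have "fls_subdegree (fls_deriv ((E ^^ i) F)) = s - int i - 1"
      using Suc s by (subst fls_subdegree_deriv) auto
    moreover from this have "fls_deriv ((E ^^ i) F) \<noteq> 0" using s by auto
    ultimately show ?case using nz sub0 by (simp add: E_def)
  qed (simp add: s_def)
  have nonzero: "(E ^^ i) F \<noteq> 0" for i
    using sub[of i] s by auto
  define k where "k = Max {i. i < m \<and> c i \<noteq> 0}"
  have "k \<in> {i. i < m \<and> c i \<noteq> 0}"
    unfolding k_def using c by (intro Max_in) auto
  hence k: "k < m" "c k \<noteq> 0" by auto
  have k_max: "c i = 0" if "i < m" "i > k" for i
  proof (rule ccontr)
    assume "c i \<noteq> 0"
    hence "i \<le> k" unfolding k_def using that by (intro Max_ge) auto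
    thus False using that by simp
  qed
  let ?G = "\<Sum>i<m. fls_const (c i) * (E ^^ i) F"
  have "fls_nth ?G (s - int k) = (\<Sum>i<m. c i * fls_nth ((E ^^ i) F) (s - int k))"
    by (simp add: fls_nth_sum)
  \<comment> \<open>At this exponent the derivatives of order below \<open>k\<close> contribute
    nothing, and those above \<open>k\<close> have coefficient 0.\<close>
  also have "\<dots> = (\<Sum>i\<in>{k}. c i * fls_nth ((E ^^ i) F) (s - int k))"
  proof (rule sum.mono_neutral_right)
    show "\<forall>i\<in>{..<m} - {k}. c i * fls_nth ((E ^^ i) F) (s - int k) = 0"
    proof
      fix i assume "i \<in> {..<m} - {k}"
      hence "i < m" "i < k \<or> i > k" by auto
      thus "c i * fls_nth ((E ^^ i) F) (s - int k) = 0"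
        using k_max[of i] sub[of i] by auto
    qed
  qed (use k in auto)
  also have "\<dots> \<noteq> 0"
    using k nonzero[of k] sub[of k] by (simp flip: sub[of k])
  finally have "fls_subdegree ?G \<le> s - int k" by (rule fls_subdegree_leI)
  hence "fls_subdegree ?G < 0" using s by simp
  moreover have "mero_expansion \<alpha> (\<Sum>i<m. mero_const (c i) * (euler_deriv ^^ i) y) ?G"
    by (intro mero_expansion_sum mero_expansion_mult mero_expansion_const e)
  ultimately show ?thesis using regular_at_iff by fastforce
qed

section \<open>Zeros and poles of the coefficient of the equation\<close>

lemma nonzero_zeros_poles_iff:
  assumes \<alpha>: "\<alpha> \<noteq> 0" and F: "mero_expansion \<alpha> a F" and a: "a \<noteq> 0"
  shows "\<alpha> \<in> nonzero_zeros_poles a \<longleftrightarrow> fls_subdegree F \<noteq> 0"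
proof -
  obtain f where f: "f meromorphic_on (-{0})" "a = abs_mero f" "(\<lambda>w. f (\<alpha> + w)) has_laurent_expansion F"
    using F by (auto simp: mero_expansion_def)
  have "F \<noteq> 0" using mero_expansion_zero_imp_zero F a by blast
  have "\<alpha> \<in> nonzero_zeros_poles a \<longleftrightarrow> (f \<midarrow>\<alpha>\<rightarrow> 0 \<or> is_pole f \<alpha>)"
    using f \<alpha> by (simp add: nonzero_zeros_poles.abs_eq mero_rel_refl_iff)
  also have "\<dots> \<longleftrightarrow> fls_subdegree F > 0 \<or> fls_subdegree F < 0"
    using tendsto_0_subdegree_iff[OF f(3) \<open>F \<noteq> 0\<close>] has_laurent_expansion_imp_is_pole_iff[OF f(3)] by simp
  finally show ?thesis by auto
qed

text \<open>A zero or pole off 0 gives the logarithmic derivative a simple pole; at any other point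
  the denominator is a unit and the numerator is regular.\<close>

lemma regular_at_log_deriv_iff:
  assumes \<alpha>: "\<alpha> \<noteq> 0" and a: "a \<noteq> 0"
  shows "regular_at \<alpha> (euler_deriv a / a) \<longleftrightarrow> \<alpha> \<notin> nonzero_zeros_poles a"
proof -
  obtain F where F: "mero_expansion \<alpha> a F" by (rule mero_expansion_exists[OF \<alpha>])
  have nz: "F \<noteq> 0" using mero_expansion_zero_imp_zero F a by blast
  let ?A = "fls_const \<alpha> + fls_X"
  have sub0: "fls_subdegree ?A = 0"
    by (rule fls_subdegree_eqI) (use \<alpha> in auto)
  hence A: "?A \<noteq> 0"
    using \<alpha> by (auto simp: fls_eq_iff dest: spec[of _ 0])
  let ?G = "?A * fls_deriv F / F"
  have G: "mero_expansion \<alpha> (euler_deriv a / a) ?G"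
    by (intro mero_expansion_divide mero_expansion_euler_deriv F)
  have "fls_subdegree ?G \<ge> 0 \<longleftrightarrow> fls_subdegree F = 0"
  proof (cases "fls_subdegree F = 0")
    case True
    hence "fls_subdegree (fls_deriv F) \<ge> 0" by (rule fls_deriv_subdegree0)
    moreover have "fls_subdegree ?G = fls_subdegree (fls_deriv F)" if "fls_deriv F \<noteq> 0"
      unfolding divide_inverse using that nz A sub0 True by simp
    ultimately show ?thesis using True by (cases "fls_deriv F = 0") auto
  next
    case False
    have d: "fls_subdegree (fls_deriv F) = fls_subdegree F - 1"
      by (rule fls_subdegree_deriv[OF False])
    have "fls_deriv F \<noteq> 0"
    proof
      assume "fls_deriv F = 0"
      hence "fls_nth (fls_deriv F) (fls_subdegree F - 1) = 0" by simp
      thus False using False nz by simp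
    qed
    hence "fls_subdegree ?G = -1"
      unfolding divide_inverse using nz A sub0 d by simp
    thus ?thesis using False by simp
  qed
  thus ?thesis
    using regular_at_iff[OF G] nonzero_zeros_poles_iff[OF \<alpha> F a] by simp
qed

text \<open>In lowest terms neither numerator nor denominator vanishes off 0, so both are
  monomials.\<close>

lemma rat_fun_no_zeros_poles:
  assumes a: "a \<in> rat_funs" "a \<noteq> 0" and "nonzero_zeros_poles a = {}"
  obtains c n where "c \<noteq> 0" "a = mero_const c * mero_X powi n"
proof -
  obtain p r where pr: "r \<noteq> 0" "a = mero_poly p / mero_poly r" "\<And>\<alpha>. poly p \<alpha> = 0 \<Longrightarrow> poly r \<alpha> \<noteq> 0"
    by (rule rat_funsE[OF a(1)]) blast
  have p: "p \<noteq> 0" using pr(2) a by (auto simp: mero_poly_0)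
  have nz: "poly p \<alpha> \<noteq> 0 \<and> poly r \<alpha> \<noteq> 0" if \<alpha>: "\<alpha> \<noteq> 0" for \<alpha>
  proof -
    obtain F where F: "mero_expansion \<alpha> a F" by (rule mero_expansion_exists[OF \<alpha>])
    have sub: "fls_subdegree F = 0" using nonzero_zeros_poles_iff[OF \<alpha> F a(2)] assms by simp
    moreover have "F \<noteq> 0" using mero_expansion_zero_imp_zero F a by blast
    ultimately have "fls_nth F 0 \<noteq> 0" by (metis nth_fls_subdegree_zero_iff)
    moreover have "fls_nth F 0 * poly r \<alpha> = poly p \<alpha>"
      by (rule expansion_poly_ratio[OF pr(2) F pr(1)]) (use regular_at_iff[OF F] sub in simp)
    ultimately show ?thesis using pr(3)[of \<alpha>] by (metis mult_eq_0_iff)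
  qed
  obtain c m where c: "c \<noteq> 0" "p = monom c m"
    using poly_only_root_0[OF p] nz by metis
  obtain d n where d: "d \<noteq> 0" "r = monom d n"
    using poly_only_root_0[OF pr(1)] nz by metis
  have "a = mero_const (c / d) * mero_X powi (int m - int n)"
    unfolding pr(2) c d mero_poly_monom
    using mero_X_nz by (simp add: divide_inverse mero_const_mult mero_const_inverse power_int_diff)
  thus thesis using that c d by (metis divide_eq_0_iff)
qed

section \<open>The first-order q-difference equation\<close>

text \<open>The field \<open>L\<close> of functions meromorphic at 0 too, encoded by the existence
  of a Laurent expansion there.\<close>

definition germ_field :: "mero set" where
  "germ_field = {g. \<exists>F. mero_expansion 0 g F}"

lemma is_subfield_germ_field: "is_subfield germ_field"
  unfolding is_subfield_def germ_field_def
  using mero_expansion_1 mero_expansion_diff mero_expansion_mult mero_expansion_inverse by blast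

lemma rat_funs_germ_field: "rat_funs \<subseteq> germ_field"
proof -
  have "mero_const c \<in> germ_field" for c
    using mero_expansion_const by (auto simp: germ_field_def)
  moreover have "mero_X \<in> germ_field"
    using mero_expansion_X by (auto simp: germ_field_def)
  ultimately show ?thesis
    unfolding rat_funs_def
    by (intro field_adjoin_least[OF is_subfield_consts is_subfield_germ_field]) auto
qed

interpretation euler: derivation euler_deriv
  by standard (rule euler_deriv_add euler_deriv_mult)+

lemma euler_deriv_power_int_X: "euler_deriv (mero_const c * mero_X powi n) = of_int n * (mero_const c * mero_X powi n)"
proof (rule mero_expansion_inject)
  let ?Y = "fls_const c * fls_X powi n :: complex fls"
  have X: "mero_expansion 0 mero_X fls_X"
    using mero_expansion_X[of 0] by simp
  have Y: "mero_expansion 0 (mero_const c * mero_X powi n) ?Y"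
    by (intro mero_expansion_mult mero_expansion_const mero_expansion_power_int X)
  show "mero_expansion 0 (euler_deriv (mero_const c * mero_X powi n)) (fls_X * fls_deriv ?Y)"
    using mero_expansion_euler_deriv[OF Y] by simp
  have "fls_X * fls_deriv ?Y = fls_const (of_int n) * ?Y"
    by (intro fls_eqI) (simp add: fls_X_times_conv_shift)
  thus "mero_expansion 0 (of_int n * (mero_const c * mero_X powi n)) (fls_X * fls_deriv ?Y)"
    unfolding mero_of_int using mero_expansion_mult[OF mero_expansion_const Y, of "of_int n"] by metis
qed

section \<open>The q-shift on expansions at 0\<close>

context
  fixes q :: complex
  assumes q: "q \<noteq> 0" and not_root_of_unity: "\<forall>n::nat. n > 0 \<longrightarrow> q ^ n \<noteq> 1"
begin

lemma power_int_eq_1_iff: "q powi n = 1 \<longleftrightarrow> n = 0"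
proof
  assume *: "q powi n = 1"
  show "n = 0"
  proof (rule ccontr)
    assume "n \<noteq> 0"
    moreover have "q ^ nat \<bar>n\<bar> = 1"
      using * by (auto simp: power_int_def abs_if power_inverse split: if_splits)
    ultimately show False using not_root_of_unity by auto
  qed
qed simp

lemma power_int_inject: "q powi m = q powi n \<longleftrightarrow> m = n"
proof -
  have "q powi m = q powi n \<longleftrightarrow> q powi (m - n) = 1"
    using q by (simp add: power_int_diff)
  thus ?thesis by (simp add: power_int_eq_1_iff)
qed

text \<open>The shift acts diagonally on Laurent coefficients at 0, with the pairwise distinct
  eigenvalues \<open>q powi n\<close>. All comparisons of coefficients rest on this.\<close>

lemma expansion_0_qshift:
  assumes "mero_expansion 0 g F"
  shows "\<exists>G. mero_expansion 0 (qshift q g) G \<and> (\<forall>n. fls_nth G n = q powi n * fls_nth F n)"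
proof (intro exI conjI allI)
  show "mero_expansion 0 (qshift q g) (fls_compose_fps F (fps_const q * fps_X))"
    using mero_expansion_qshift[OF q, of 0 g F] assms by simp
  show "fls_nth (fls_compose_fps F (fps_const q * fps_X)) n = q powi n * fls_nth F n" for n
    unfolding fls_nth_fls_compose_fps_linear[OF q] by (rule mult.commute)
qed

interpretation qdf: difference_field "qshift q"
  by standard (simp_all add: qshift_add[OF q] qshift_mult[OF q] qshift_const[OF q] flip: mero_const_1)

lemma qshift_rat_funs:
  assumes "g \<in> rat_funs"
  shows "qshift q g \<in> rat_funs"
proof -
  note F = is_subfield_rat_funs
  have "qshift q (mero_poly p) \<in> rat_funs" for p
    by (induction p)
       (auto simp: mero_poly_pCons mero_poly_0 qdf.shift_simps qshift_const[OF q] qshift_X[OF q]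
         intro!: subfield_add[OF F] subfield_mult[OF F] subfield_0[OF F] const_rat_funs X_rat_funs)
  moreover obtain p r where "g = mero_poly p / mero_poly r"
    by (rule rat_funsE[OF assms])
  ultimately show ?thesis
    by (simp add: qdf.shift_divide subfield_divide[OF F])
qed

text \<open>A coefficient with index \<open>n\<close> of a fixed series is multiplied by
  \<open>q powi n - 1\<close> to give 0, so only the constant term survives.\<close>

lemma qshift_fixed_const:
  assumes "g \<in> germ_field" "qshift q g = g"
  shows "g \<in> range mero_const"
proof -
  obtain F where F: "mero_expansion 0 g F" using assms by (auto simp: germ_field_def)
  obtain G where G: "mero_expansion 0 g G" "\<And>n. fls_nth G n = q powi n * fls_nth F n"
    using expansion_0_qshift[OF F] assms by auto
  have "F = G" by (rule mero_expansion_unique[OF F G(1)])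
  hence "fls_nth F n = 0" if "n \<noteq> 0" for n
    using G(2)[of n] power_int_eq_1_iff[of n] that by auto
  hence "F = fls_const (fls_nth F 0)" by (intro fls_eqI) simp
  hence "g = mero_const (fls_nth F 0)"
    using F mero_expansion_const mero_expansion_inject by metis
  thus ?thesis by blast
qed

interpretation qdf: differential_difference_subfield "qshift q" germ_field rat_funs euler_deriv
proof
  show "is_subfield germ_field" "is_subfield rat_funs" "rat_funs \<subseteq> germ_field"
    by (rule is_subfield_germ_field is_subfield_rat_funs rat_funs_germ_field)+
  show "qshift q x \<in> rat_funs" if "x \<in> rat_funs" for x
    using that by (rule qshift_rat_funs)
  show "x \<in> rat_funs" if "x \<in> germ_field" "qshift q x = x" for x
    using qshift_fixed_const[OF that] const_rat_funs by auto
  show "euler_deriv (qshift q x) = qshift q (euler_deriv x)" for x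
    by (rule qshift_euler_deriv[OF q])
  show "euler_deriv x \<in> rat_funs" if "x \<in> rat_funs" for x
  proof (rule euler.deriv_field_adjoin[OF is_subfield_consts is_subfield_rat_funs])
    show "x \<in> field_adjoin (range mero_const) mero_X"
      using that by (simp add: rat_funs_def)
    show "euler_deriv c \<in> rat_funs" if "c \<in> range mero_const" for c
      using that subfield_0[OF is_subfield_rat_funs] by (auto simp: euler_deriv_const)
  qed (auto simp: const_rat_funs X_rat_funs euler_deriv_X)
  show "euler_deriv x \<in> germ_field" if "x \<in> germ_field" for x
    using that mero_expansion_euler_deriv by (auto simp: germ_field_def)
qed

lemma qdf_C: "qdf.C = range mero_const"
proof
  show "qdf.C \<subseteq> range mero_const"
    using qshift_fixed_const by (auto simp: qdf.C_def)
  show "range mero_const \<subseteq> qdf.C"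
    using rat_funs_germ_field const_rat_funs by (auto simp: qdf.C_def qshift_const[OF q])
qed

text \<open>On coefficients the operator multiplies by \<open>q powi n - c\<close>, which vanishes
  for at most one \<open>n\<close>; beyond that index and \<open>N\<close> the coefficients of
  \<open>h\<close> are 0.\<close>

lemma finite_expansion_equation_rat_funs:
  assumes h: "h \<in> germ_field"
    and B: "mero_expansion 0 (qshift q h - mero_const c * h) B" "\<And>n. n > N \<Longrightarrow> fls_nth B n = 0"
  shows "h \<in> rat_funs"
proof -
  obtain H where H: "mero_expansion 0 h H" using h by (auto simp: germ_field_def)
  obtain G where G: "mero_expansion 0 (qshift q h) G" "\<And>n. fls_nth G n = q powi n * fls_nth H n"
    using expansion_0_qshift[OF H] by auto
  have "B = G - fls_const c * H"
    by (rule mero_expansion_unique[OF B(1)])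
       (intro mero_expansion_diff mero_expansion_mult mero_expansion_const H G)
  hence nth: "fls_nth B n = (q powi n - c) * fls_nth H n" for n
    by (simp add: G(2) left_diff_distrib)
  \<comment> \<open>If no power of \<open>q\<close> equals \<open>c\<close>, any \<open>n0\<close>
    will do.\<close>
  obtain n0 where n0: "\<And>n. q powi n = c \<Longrightarrow> n = n0"
    using power_int_inject by metis
  show ?thesis
  proof (rule finite_expansion_rat_funs[OF H])
    fix n assume "n > max N n0"
    thus "fls_nth H n = 0"
      using nth[of n] B(2)[of n] n0[of n] by auto
  qed
qed

text \<open>The poles of \<open>y\<close> off 0 are among the finitely many poles of the rational
  combination, so subtracting a rational \<open>f\<close> leaves \<open>h\<close> regular off 0.
  Then \<open>qshift q h - mero_const c * h\<close> is a Laurent polynomial, and comparing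
  coefficients makes \<open>h\<close> rational.\<close>

lemma constant_coefficient_rat_funs:
  assumes y: "y \<in> germ_field" and eq: "qshift q y = mero_const c * y + \<beta>" and \<beta>: "\<beta> \<in> rat_funs"
    and d: "\<And>i. d i \<in> qdf.C" "\<exists>i<m. d i \<noteq> 0" "(\<Sum>i<m. d i * (euler_deriv ^^ i) y) \<in> rat_funs"
  shows "y \<in> rat_funs"
proof -
  note F = is_subfield_rat_funs
  have "\<exists>e. d i = mero_const e" for i using d(1)[of i] by (auto simp: qdf_C)
  then obtain e where e: "\<And>i. d i = mero_const (e i)" by metis
  have e_nz: "\<exists>i<m. e i \<noteq> 0" using d(2) by (auto simp: e mero_const_eq_0_iff)
  let ?r = "\<Sum>i<m. mero_const (e i) * (euler_deriv ^^ i) y"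
  have "finite {\<alpha>. \<alpha> \<noteq> 0 \<and> \<not> regular_at \<alpha> ?r}"
    using d(3) by (intro finite_poles_rat_funs) (simp add: e)
  then obtain f where f: "f \<in> rat_funs" "\<And>\<alpha>. \<alpha> \<noteq> 0 \<Longrightarrow> regular_at \<alpha> (y - f)"
    using remove_poles[of "{\<alpha>. \<alpha> \<noteq> 0 \<and> \<not> regular_at \<alpha> ?r}" y] deriv_combination_pole[OF _ _ e_nz] by auto
  define h where "h = y - f"
  have h: "h \<in> germ_field"
    unfolding h_def using y f rat_funs_germ_field by (intro subfield_diff[OF is_subfield_germ_field]) auto
  have "qshift q h - mero_const c * h = \<beta> - qshift q f + mero_const c * f"
    by (simp add: h_def qdf.shift_diff eq algebra_simps)
  also have "\<dots> \<in> rat_funs"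
    using f \<beta> by (intro subfield_add[OF F] subfield_diff[OF F] subfield_mult[OF F] const_rat_funs qshift_rat_funs)
  finally have "qshift q h - mero_const c * h \<in> rat_funs" .
  moreover have "regular_at \<alpha> (qshift q h - mero_const c * h)" if "\<alpha> \<noteq> 0" for \<alpha>
    using that q f(2) unfolding h_def[symmetric]
    by (intro regular_at_diff regular_at_mult regular_at_const) (auto simp: regular_at_qshift_iff[OF q])
  ultimately obtain B N where "mero_expansion 0 (qshift q h - mero_const c * h) B" "\<forall>n>N. fls_nth B n = 0"
    using regular_rat_fun_expansion_finite by blast
  hence "h \<in> rat_funs"
    using finite_expansion_equation_rat_funs[OF h] by blast
  thus ?thesis
    using subfield_add[OF F _ f(1), of h] by (simp add: h_def)
qed

text \<open>On the orbit of a zero or pole \<open>\<beta>\<close> of \<open>a\<close> the function \<open>euler_deriv a / a\<close> has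
  exactly one pole, whereas \<open>qshift q g - g\<close> with \<open>g\<close> rational has none or at least two.\<close>

lemma additive_equation_no_zeros_poles:
  assumes sf: "standard_form q a" and a: "a \<noteq> 0" and g: "g \<in> rat_funs"
    and eq: "qshift q g = g + euler_deriv a / a"
  shows "nonzero_zeros_poles a = {}"
proof (rule ccontr)
  assume "nonzero_zeros_poles a \<noteq> {}"
  then obtain \<beta> where \<beta>: "\<beta> \<in> nonzero_zeros_poles a" by blast
  have \<beta>0: "\<beta> \<noteq> 0" using \<beta> by transfer auto
  define b where "b i = q powi i * \<beta>" for i
  have b0: "b i \<noteq> 0" for i using \<beta>0 q by (simp add: b_def)
  have b_Suc: "q * b i = b (i + 1)" for i using q by (simp add: b_def power_int_add)
  have inj: "inj b" using \<beta>0 by (auto simp: inj_def b_def power_int_inject)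
  define R where "R i = regular_at (b i) g" for i
  have R_shift: "regular_at (b i) (qshift q g) \<longleftrightarrow> R (i + 1)" for i
    by (simp add: R_def regular_at_qshift_iff[OF q b0] b_Suc)
  \<comment> \<open>By the standard form \<open>\<beta>\<close> is the only zero or pole of
    \<open>a\<close> on its orbit, so regularity of \<open>g\<close> passes between neighbouring
    orbit points except between the indices 0 and 1.\<close>
  have step: "R (i + 1) = R i" if "i \<noteq> 0" for i
  proof -
    have "b i \<noteq> \<beta>" using inj that unfolding inj_def b_def by (metis mult_1 power_int_0_right)
    hence "b i \<notin> nonzero_zeros_poles a"
      using sf \<beta> unfolding standard_form_def b_def by blast
    hence reg: "regular_at (b i) (euler_deriv a / a)"
      using regular_at_log_deriv_iff[OF b0 a] by blast
    have "R i \<Longrightarrow> R (i + 1)"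
      using regular_at_add[OF _ reg, of g] R_shift[of i] eq by (simp add: R_def)
    moreover have "R (i + 1) \<Longrightarrow> R i"
      using regular_at_diff[OF _ reg, of "qshift q g"] R_shift[of i] eq by (simp add: R_def)
    ultimately show ?thesis by blast
  qed
  have "finite (b -` {\<alpha>. \<alpha> \<noteq> 0 \<and> \<not> regular_at \<alpha> g})"
    by (rule finite_vimageI[OF finite_poles_rat_funs[OF g] inj])
  moreover have "{i. \<not> R i} = b -` {\<alpha>. \<alpha> \<noteq> 0 \<and> \<not> regular_at \<alpha> g}"
    using b0 by (auto simp: R_def)
  ultimately have fin: "finite {i. \<not> R i}" by simp
  have up: "R (int n + 1) = R 1" for n
  proof (induction n)
    case (Suc n)
    have "int (Suc n) + 1 = (int n + 1) + 1" by simp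
    moreover have "R ((int n + 1) + 1) = R (int n + 1)"
      by (rule step) simp
    ultimately show ?case using Suc by metis
  qed simp
  have down: "R (- int n) = R 0" for n
  proof (induction n)
    case (Suc n)
    have "- int (Suc n) + 1 = - int n" by simp
    moreover have "R (- int (Suc n) + 1) = R (- int (Suc n))"
      by (rule step) simp
    ultimately show ?case using Suc by metis
  qed simp
  \<comment> \<open>A pole at index 1 would spread to all larger indices, and one at index 0 to all
    smaller ones, but \<open>g\<close> has finitely many poles.\<close>
  have "R 1"
  proof (rule ccontr)
    assume "\<not> R 1"
    hence "range (\<lambda>n. int n + 1) \<subseteq> {i. \<not> R i}" using up by auto
    hence "finite (range (\<lambda>n. int n + 1))" using fin finite_subset by blast
    thus False using finite_imageD[of "\<lambda>n. int n + 1" UNIV] by (simp add: inj_def)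
  qed
  moreover have "R 0"
  proof (rule ccontr)
    assume "\<not> R 0"
    hence "range (\<lambda>n. - int n) \<subseteq> {i. \<not> R i}" using down by auto
    hence "finite (range (\<lambda>n. - int n))" using fin finite_subset by blast
    thus False using finite_imageD[of "\<lambda>n. - int n" UNIV] by (simp add: inj_def)
  qed
  ultimately have "regular_at (b 0) (qshift q g - g)"
    using R_shift[of 0] by (intro regular_at_diff) (auto simp: R_def)
  hence "regular_at \<beta> (euler_deriv a / a)" by (simp add: eq b_def)
  thus False using regular_at_log_deriv_iff[OF \<beta>0 a] \<beta> by blast
qed

lemma diff_algebraic_imp_rat_fun:
  assumes a: "a \<in> rat_funs" "a \<noteq> 0" and b: "b \<in> rat_funs" and sf: "standard_form q a"
    and z: "z \<in> germ_field" and eq: "qshift q z = a * z + b"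
    and alg: "diff_algebraic_over euler_deriv (k_field q) z"
  shows "z \<in> rat_funs"
proof (rule ccontr)
  assume z_rat: "z \<notin> rat_funs"
  have "\<exists>n. (euler_deriv ^^ n) z \<in> tower rat_funs (\<lambda>i. (euler_deriv ^^ i) z) n"
  proof (rule qdf.diff_algebraic_imp_in_deriv_tower[OF _ z X_rat_funs])
    show "qshift q x \<in> germ_field" if "x \<in> germ_field" for x
      using that expansion_0_qshift unfolding germ_field_def by blast
    show "p = 0" if "coeffs_in qdf.C p" "poly p mero_X = 0" for p
      using that coeffs_in_consts[of p] by (auto simp: qdf_C mero_poly_eq_0_iff simp flip: mero_poly_def)
    show "diff_algebraic_over euler_deriv (field_adjoin {x. qshift q x = x} mero_X) z"
      using alg by (simp add: k_field_def k0_field_def)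
  qed
  then obtain n where n: "(euler_deriv ^^ n) z \<in> tower rat_funs (\<lambda>i. (euler_deriv ^^ i) z) n" by blast
  obtain g m d where g: "g \<in> germ_field" "qshift q g = g + euler_deriv a / a"
    and d: "\<And>i. d i \<in> qdf.C" "\<exists>i<m. d i \<noteq> 0" "(\<Sum>i<m. d i * (euler_deriv ^^ i) g) \<in> rat_funs"
    using qdf.deriv_combination_additive[OF z a b eq z_rat n] by blast
  have "g \<in> rat_funs"
  proof (rule constant_coefficient_rat_funs[OF g(1) _ _ d])
    show "qshift q g = mero_const 1 * g + euler_deriv a / a"
      using g by (simp add: mero_const_1)
    show "euler_deriv a / a \<in> rat_funs"
      using a by (intro subfield_divide[OF is_subfield_rat_funs] qdf.deriv_K)
  qed
  hence "nonzero_zeros_poles a = {}"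
    by (rule additive_equation_no_zeros_poles[OF sf a(2) _ g(2)])
  then obtain c k where c: "c \<noteq> 0" "a = mero_const c * mero_X powi k"
    using rat_fun_no_zeros_poles[OF a] by blast
  have "euler_deriv a = of_int k * a"
    unfolding c(2) by (rule euler_deriv_power_int_X)
  hence log_deriv: "euler_deriv a / a = mero_const (of_int k)"
    using a by (simp add: mero_of_int)
  \<comment> \<open>The shift keeps the constant coefficient at 0, because
    \<open>q powi 0 = 1\<close>, so the constant \<open>k\<close> that it adds to \<open>g\<close>
    must vanish.\<close>
  have "k = 0"
  proof -
    obtain F where F: "mero_expansion 0 g F" using g by (auto simp: germ_field_def)
    obtain G where G: "mero_expansion 0 (qshift q g) G" "\<And>n. fls_nth G n = q powi n * fls_nth F n"
      using expansion_0_qshift[OF F] by auto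
    have "G = F + fls_const (of_int k)"
      using mero_expansion_unique[OF G(1)] mero_expansion_add[OF F mero_expansion_const[of 0 "of_int k"]]
        g(2) log_deriv by simp
    hence "fls_nth G 0 = fls_nth F 0 + of_int k" by simp
    thus ?thesis using G(2)[of 0] by simp
  qed
  hence a_eq: "a = mero_const c" using c by simp
  obtain m d where d: "\<And>i. d i \<in> qdf.C" "\<exists>i<m. d i \<noteq> 0" "(\<Sum>i<m. d i * (euler_deriv ^^ i) z) \<in> rat_funs"
    using qdf.deriv_combination_constant[OF z a b eq _ n] by (auto simp: a_eq euler_deriv_const)
  have "z \<in> rat_funs"
    by (rule constant_coefficient_rat_funs[OF z eq[unfolded a_eq] b d])
  thus False using z_rat by contradiction
qed

text \<open>For \<open>z - f\<close> the right-hand side reduces to the single term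
  \<open>mero_const d * mero_X powi r\<close>, which has a finite expansion at 0.\<close>

lemma resonant_solution_rat_fun:
  assumes z: "z \<in> germ_field" and eq: "qshift q z = mero_const (q powi r) * z + b"
    and f: "f \<in> rat_funs" and b: "b = qshift q f - mero_const (q powi r) * f + mero_const d * mero_X powi r"
  shows "z \<in> rat_funs"
proof -
  have h: "z - f \<in> germ_field"
    using z f rat_funs_germ_field by (intro subfield_diff[OF is_subfield_germ_field]) auto
  have X: "mero_expansion 0 mero_X fls_X"
    using mero_expansion_X[of 0] by simp
  have B: "mero_expansion 0 (mero_const d * mero_X powi r) (fls_const d * fls_X powi r)"
    by (intro mero_expansion_mult mero_expansion_const mero_expansion_power_int X)
  have "qshift q (z - f) - mero_const (q powi r) * (z - f) = mero_const d * mero_X powi r"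
    by (simp add: qdf.shift_diff eq b algebra_simps)
  from B[folded this] have "z - f \<in> rat_funs"
    by (rule finite_expansion_equation_rat_funs[OF h, where N = r]) auto
  thus ?thesis using subfield_add[OF is_subfield_rat_funs _ f, of "z - f"] by simp
qed

text \<open>\<open>z - f\<close> solves the homogeneous equation. The shift keeps the order at 0 and
  the monomial adds \<open>n\<close> to it, so a nonzero solution forces \<open>n = 0\<close>, and
  the coefficient comparison applies with right-hand side 0.\<close>

lemma monomial_solution_rat_fun:
  assumes z: "z \<in> germ_field" and eq: "qshift q z = mero_const c * mero_X powi n * z + b"
    and c: "c \<noteq> 0" and f: "f \<in> rat_funs" and b: "b = qshift q f - mero_const c * mero_X powi n * f"
  shows "z \<in> rat_funs"
proof -
  have h: "z - f \<in> germ_field"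
    using z f rat_funs_germ_field by (intro subfield_diff[OF is_subfield_germ_field]) auto
  have h_eq: "qshift q (z - f) = mero_const c * mero_X powi n * (z - f)"
    by (simp add: qdf.shift_diff eq b algebra_simps)
  have "z - f \<in> rat_funs"
  proof (cases "z - f = 0")
    case True
    thus ?thesis using subfield_0[OF is_subfield_rat_funs] by simp
  next
    case False
    obtain H where H: "mero_expansion 0 (z - f) H" using h by (auto simp: germ_field_def)
    have "H \<noteq> 0" using False H mero_expansion_zero_imp_zero by blast
    obtain G where G: "mero_expansion 0 (qshift q (z - f)) G" "\<And>n. fls_nth G n = q powi n * fls_nth H n"
      using expansion_0_qshift[OF H] by auto
    have X: "mero_expansion 0 mero_X fls_X"
      using mero_expansion_X[of 0] by simp
    have "mero_expansion 0 (qshift q (z - f)) (fls_const c * fls_X powi n * H)"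
      unfolding h_eq by (intro mero_expansion_mult mero_expansion_const mero_expansion_power_int X H)
    hence "G = fls_const c * fls_X powi n * H"
      by (rule mero_expansion_unique[OF G(1)])
    moreover have "fls_subdegree (fls_const c * fls_X powi n * H) = n + fls_subdegree H"
      using c \<open>H \<noteq> 0\<close> by simp
    moreover have "fls_subdegree G = fls_subdegree H"
      using q \<open>H \<noteq> 0\<close> by (intro fls_subdegree_eqI) (auto simp: G(2))
    ultimately have "n = 0" by simp
    hence "qshift q (z - f) - mero_const c * (z - f) = 0"
      using h_eq by simp
    thus ?thesis
      using mero_expansion_0 by (intro finite_expansion_equation_rat_funs[OF h, where B = 0 and N = 0 and c = c]) auto
  qed
  thus ?thesis using subfield_add[OF is_subfield_rat_funs _ f, of "z - f"] by simp
qed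

text \<open>Constants are fixed by the shift; through this inclusion, a solution outside
  \<open>k\<close> is also not rational.\<close>

lemma rat_funs_subset_k_field: "rat_funs \<subseteq> k_field q"
  unfolding rat_funs_def k_field_def
proof (rule field_adjoin_least[OF is_subfield_consts])
  have k0: "is_subfield (k0_field q)"
    using qdf.is_subfield_fixed by (simp add: k0_field_def)
  show "is_subfield (field_adjoin (k0_field q) mero_X)" "mero_X \<in> field_adjoin (k0_field q) mero_X"
    by (rule is_subfield_field_adjoin[OF k0] field_adjoin_gen[OF k0])+
  have "range mero_const \<subseteq> k0_field q"
    by (auto simp: k0_field_def qshift_const[OF q])
  thus "range mero_const \<subseteq> field_adjoin (k0_field q) mero_X"
    using field_adjoin_base[OF k0] by blast
qed

end

theorem proposition3p10:
  fixes q :: complex and a b :: mero and z :: "complex \<Rightarrow> complex"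
  assumes "q \<noteq> 0" and "\<forall>n::nat. n > 0 \<longrightarrow> q ^ n \<noteq> 1"
    and "a \<in> rat_funs" and "b \<in> rat_funs" and "a \<noteq> 0" and "standard_form q a"
    and "z meromorphic_on UNIV"
    and "qshift q (abs_mero z) = a * abs_mero z + b"
    and "abs_mero z \<notin> k_field q"
  shows "((\<forall>c n. a \<noteq> mero_const c * mero_X powi n) \<longrightarrow>
            \<not> diff_algebraic_over euler_deriv (k_field q) (abs_mero z)) \<and>
         ((\<exists>c n. a = mero_const c * mero_X powi n) \<longrightarrow>
            (diff_algebraic_over euler_deriv (k_field q) (abs_mero z) \<longleftrightarrow>
              (\<exists>r::int. a = mero_const (q powi r) \<and>
                 (\<exists>f\<in>rat_funs. \<exists>d. b = qshift q f - a * f + mero_const d * mero_X powi r)) \<or>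
              ((\<forall>r::int. a \<noteq> mero_const (q powi r)) \<and>
                 (\<exists>f\<in>rat_funs. b = qshift q f - a * f))))"
proof -
  note q = assms(1,2)
  have z: "abs_mero z \<in> germ_field"
    using mero_expansion_abs_mero[OF assms(7)] unfolding germ_field_def by blast
  have z_rat: "abs_mero z \<notin> rat_funs"
    using rat_funs_subset_k_field[OF q] assms(9) by blast
  have not_alg: "\<not> diff_algebraic_over euler_deriv (k_field q) (abs_mero z)"
    using diff_algebraic_imp_rat_fun[OF q assms(3,5,4,6) z assms(8)] z_rat by blast
  moreover have False
    if "a = mero_const (q powi r)" "f \<in> rat_funs" "b = qshift q f - a * f + mero_const d * mero_X powi r"
    for r f d
    using resonant_solution_rat_fun[OF q z, of r b f d] assms(8) that z_rat by simp
  moreover have False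
    if "a = mero_const c * mero_X powi n" "f \<in> rat_funs" "b = qshift q f - a * f" for c n f
  proof -
    have "c \<noteq> 0" using assms(5) that(1) by (auto simp: mero_const_0)
    thus False
      using monomial_solution_rat_fun[OF q z, of c n b f] assms(8) that z_rat by simp
  qed
  ultimately show ?thesis by blast
qed

end
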